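(* Consider the model and dynamics described in the context, with constants $a>b>0$, $\alpha\in\mathbb{R}$, $\eta\in(0,1]$, $\lambda_n\to\infty$, and community-size limits $v^1,v^2\in(0,\infty)$. Assume that $v^1\ge v^2$ and, if $v^1>v^2$, that $$\frac{bv^1-av^2}{v^1-v^2}<\alpha<\frac{av^1-bv^2}{v^1-v^2}$$ (if $v^1=v^2$, $\alpha$ may be any real number). Let $\beta_n\in(0,\infty]$ satisfy $\lim_{n\to\infty}\frac{\beta_n\lambda_n}{\log\lambda_n}=\infty$. Let $t_n=c\log\lambda_n$ with $0<c<1/4$. Then $$\max\big\{|\boldsymbol{z}^1_n(t_n)-1|,\ |\boldsymbol{z}^2_n(t_n)+1|\big\}\Rightarrow0\quad\text{as }n\to\infty,$$ and this convergence also holds in expectation, i.e. $E\big[\max\{|\boldsymbol{z}^1_n(t_n)-1|,|\boldsymbol{z}^2_n(t_n)+1|\}\big]\to0$.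
   Context: Model: for each $n$, the node set $\mathcal{V}_n=\mathcal{V}_n^1\cup\mathcal{V}_n^2$ is a disjoint union of two communities of sizes $V_n^k=|\mathcal{V}_n^k|$ with $V_n^k/n\to v^k\in(0,\infty)$, $k=1,2$. The graph $\mathcal{G}_n$ on $\mathcal{V}_n$ is a stochastic block model: each unordered pair of distinct nodes is an edge independently, with probability $a_n=a\lambda_n/n$ if both nodes are in the same community and $b_n=b\lambda_n/n$ otherwise, where $a>b>0$ are constants and $\lambda_n\to\infty$. Write $u\sim v$ if $\{u,v\}$ is an edge. A configuration is a map $\sigma:\mathcal{V}_n\to\{-1,1\}$. Let $\alpha_n=\alpha\lambda_n/n$ and define $\Delta_n(\sigma,u)=2\sigma(u)\big[\sum_{v\sim u}\sigma(v)-\alpha_n\sum_{v\neq u}\sigma(v)\big]$. Let $r(x)=1/(1+e^x)$; when $\beta_n=\infty$ one uses the convention $r(\beta_n x)=\mathbf{1}\{x<0\}+\tfrac12\mathbf{1}\{x=0\}$. Dynamics (Glauber dynamics): given $\mathcal{G}_n$, $\boldsymbol{\sigma}_n(t)$ is the continuous-time Markov chain on configurations in which the spin of each node $u$ flips independently at rate $r(\beta_n\Delta_n(\boldsymbol{\sigma}_n(t),u))$. Initialization: independently for each node $u$, with probability $\eta$ the spin is set to $\boldsymbol{\sigma}_n(0,u)=\mathbf{1}\{u\in\mathcal{V}_n^1\}-\mathbf{1}\{u\in\mathcal{V}_n^2\}$, and otherwise $\boldsymbol{\sigma}_n(0,u)$ is uniform on $\{-1,1\}$. Magnetizations: $\boldsymbol{z}^k_n(t)=\frac{1}{V_n^k}\sum_{u\in\mathcal{V}_n^k}\boldsymbol{\sigma}_n(t,u)$.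 $\Rightarrow$ denotes weak convergence (here to a constant, i.e. convergence in probability). *)

theory Defs
  imports Complex_Main "HOL-Library.Extended_Real" "HOL-Library.FuncSet"
begin

text \<open>Node set: {0..<V1+V2}; community 1 = {0..<V1}, community 2 = {V1..<V1+V2}.
  Undirected simple graphs are sets of pairs (u,v) with u < v < N.\<close>

definition pairs :: "nat \<Rightarrow> (nat \<times> nat) set" where
  "pairs N = {(u, v). u < v \<and> v < N}"

definition adj :: "(nat \<times> nat) set \<Rightarrow> nat \<Rightarrow> nat \<Rightarrow> bool" where
  "adj E u v = (u \<noteq> v \<and> (min u v, max u v) \<in> E)"

definition edge_prob :: "nat \<Rightarrow> real \<Rightarrow> real \<Rightarrow> nat \<times> nat \<Rightarrow> real" where
  "edge_prob V1 pin pout p = (if (fst p < V1) = (snd p < V1) then pin else pout)"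

definition graph_prob :: "nat \<Rightarrow> nat \<Rightarrow> real \<Rightarrow> real \<Rightarrow> (nat \<times> nat) set \<Rightarrow> real" where
  "graph_prob N V1 pin pout E =
     (\<Prod>p\<in>pairs N. if p \<in> E then edge_prob V1 pin pout p else 1 - edge_prob V1 pin pout p)"

definition configs :: "nat \<Rightarrow> (nat \<Rightarrow> real) set" where
  "configs N = PiE {0..<N} (\<lambda>_. {-1, 1})"

definition flip_rate :: "ereal \<Rightarrow> real \<Rightarrow> real" where
  "flip_rate \<beta> x = (if \<beta> = \<infinity> then (if x < 0 then 1 else if x = 0 then 1/2 else 0)
                     else 1 / (1 + exp (real_of_ereal \<beta> * x)))"

definition Delta :: "nat \<Rightarrow> (nat \<times> nat) set \<Rightarrow> real \<Rightarrow> (nat \<Rightarrow> real) \<Rightarrow> nat \<Rightarrow> real" where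
  "Delta N E alph \<sigma> u =
     2 * \<sigma> u * ((\<Sum>v\<in>{v. v < N \<and> adj E u v}. \<sigma> v) - alph * (\<Sum>v\<in>{0..<N} - {u}. \<sigma> v))"

definition flip :: "(nat \<Rightarrow> real) \<Rightarrow> nat \<Rightarrow> (nat \<Rightarrow> real)" where
  "flip \<sigma> u = \<sigma>(u := - \<sigma> u)"

definition generator :: "nat \<Rightarrow> (nat \<times> nat) set \<Rightarrow> real \<Rightarrow> ereal \<Rightarrow> (nat \<Rightarrow> real) \<Rightarrow> (nat \<Rightarrow> real) \<Rightarrow> real" where
  "generator N E alph \<beta> \<sigma> \<sigma>' =
     (if \<sigma>' = \<sigma> then - (\<Sum>u<N. flip_rate \<beta> (Delta N E alph \<sigma> u))
      else (\<Sum>u\<in>{u. u < N \<and> \<sigma>' = flip \<sigma> u}. flip_rate \<beta> (Delta N E alph \<sigma> u)))"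

fun mat_pow :: "'s set \<Rightarrow> ('s \<Rightarrow> 's \<Rightarrow> real) \<Rightarrow> nat \<Rightarrow> 's \<Rightarrow> 's \<Rightarrow> real" where
  "mat_pow S Q 0 x y = (if x = y then 1 else 0)"
| "mat_pow S Q (Suc k) x y = (\<Sum>z\<in>S. Q x z * mat_pow S Q k z y)"

definition ctmc_trans :: "'s set \<Rightarrow> ('s \<Rightarrow> 's \<Rightarrow> real) \<Rightarrow> real \<Rightarrow> 's \<Rightarrow> 's \<Rightarrow> real" where
  "ctmc_trans S Q t x y = (\<Sum>k. t ^ k / fact k * mat_pow S Q k x y)"

text \<open>Initial law: independently, with prob. eta the true label, otherwise uniform.\<close>
definition init_prob :: "nat \<Rightarrow> nat \<Rightarrow> real \<Rightarrow> (nat \<Rightarrow> real) \<Rightarrow> real" where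
  "init_prob N V1 \<eta> \<sigma> =
     (\<Prod>u<N. \<eta> * (if \<sigma> u = (if u < V1 then 1 else -1) then 1 else 0) + (1 - \<eta>) / 2)"

definition magnet :: "nat set \<Rightarrow> (nat \<Rightarrow> real) \<Rightarrow> real" where
  "magnet A \<sigma> = (\<Sum>u\<in>A. \<sigma> u) / real (card A)"

definition expect_at :: "nat \<Rightarrow> nat \<Rightarrow> real \<Rightarrow> real \<Rightarrow> real \<Rightarrow> ereal \<Rightarrow> real \<Rightarrow> real
                         \<Rightarrow> ((nat \<Rightarrow> real) \<Rightarrow> real) \<Rightarrow> real" where
  "expect_at V1 V2 pin pout alph \<beta> \<eta> t f =
     (let N = V1 + V2 in
      \<Sum>E\<in>Pow (pairs N). graph_prob N V1 pin pout E *
        (\<Sum>\<sigma>0\<in>configs N. init_prob N V1 \<eta> \<sigma>0 *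
          (\<Sum>\<sigma>\<in>configs N. ctmc_trans (configs N) (generator N E alph \<beta>) t \<sigma>0 \<sigma> * f \<sigma>)))"

definition err :: "nat \<Rightarrow> nat \<Rightarrow> (nat \<Rightarrow> real) \<Rightarrow> real" where
  "err V1 V2 \<sigma> = max \<bar>magnet {0..<V1} \<sigma> - 1\<bar> \<bar>magnet {V1..<V1 + V2} \<sigma> + 1\<bar>"

end

theory Submission
  imports Defs "HOL-Real_Asymp.Real_Asymp"
begin

text \<open>
  Let \<open>m t = 1 - (1 - \<eta>) exp (- t)\<close> and let \<open>D\<close> be the squared distance of the two magnetisations
  from the point \<open>(m t, - m t)\<close>. While \<open>D\<close> is small, the assumptions on \<open>\<alpha>\<close> give the mean field at
  every node the sign of its community with a margin of order \<open>\<lambda>\<close>. A Chernoff bound and a union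
  bound over pairs of sign vectors show that, with high probability, the fluctuation of the
  adjacency matrix applied to \<^emph>\<open>any\<close> configuration has \<open>\<ell>\<^sub>1\<close> norm at most \<open>C n \<surd>\<lambda>\<close>, so all but
  \<open>O(n / \<surd>\<lambda>)\<close> nodes are pushed towards their label at nearly full rate and \<open>D\<close> has drift
  \<open>O(1 / \<lambda>)\<close>. The function \<open>1 - exp (- k D)\<close> with \<open>k = \<surd>\<lambda>\<close> is concave in \<open>D\<close> and almost flat where \<open>D\<close>
  is not small, so its drift is small everywhere, even where that of \<open>D\<close> is not. Hence its
  expectation stays small up to times of order \<open>ln \<lambda>\<close>, without any stopping time argument, and
  \<open>m t\<close> is close to 1 by then.
\<close>

section \<open>Exponentials of rate matrices\<close>

text \<open>A matrix commutes with its powers. \<open>mat_pow\<close> splits off the first factor;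
  the forward equation needs the last one.\<close>

lemma mat_pow_Suc_right:
  assumes "finite S" "x \<in> S" "y \<in> S"
  shows "mat_pow S Q (Suc k) x y = (\<Sum>z\<in>S. mat_pow S Q k x z * Q z y)"
  using assms(2)
proof (induction k arbitrary: x)
  case 0
  then show ?case using assms by (simp add: if_distrib[of "\<lambda>u. u * _"] if_distrib[of "\<lambda>u. _ * u"] cong: if_cong)
next
  case (Suc k)
  have "mat_pow S Q (Suc (Suc k)) x y = (\<Sum>z\<in>S. Q x z * (\<Sum>w\<in>S. mat_pow S Q k z w * Q w y))"
    using Suc.IH by simp
  also have "\<dots> = (\<Sum>w\<in>S. \<Sum>z\<in>S. Q x z * (mat_pow S Q k z w * Q w y))"
    unfolding sum_distrib_left by (rule sum.swap)
  also have "\<dots> = (\<Sum>w\<in>S. mat_pow S Q (Suc k) x w * Q w y)"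
    by (simp add: sum_distrib_right mult.assoc)
  finally show ?case .
qed

text \<open>The sum of all absolute entries dominates every absolute row sum. This crude norm
  suffices for absolute convergence of the exponential series.\<close>

lemma abs_mat_pow_le:
  assumes "finite S" "x \<in> S"
  shows "\<bar>mat_pow S Q k x y\<bar> \<le> (\<Sum>w\<in>S. \<Sum>z\<in>S. \<bar>Q w z\<bar>) ^ k"
  using assms(2)
proof (induction k arbitrary: x)
  case 0
  then show ?case by simp
next
  case (Suc k)
  let ?M = "\<Sum>w\<in>S. \<Sum>z\<in>S. \<bar>Q w z\<bar>"
  have M: "?M \<ge> 0" by (intro sum_nonneg) auto
  have "\<bar>mat_pow S Q (Suc k) x y\<bar> \<le> (\<Sum>z\<in>S. \<bar>Q x z\<bar> * \<bar>mat_pow S Q k z y\<bar>)"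
    unfolding mat_pow.simps abs_mult[symmetric] by (rule sum_abs)
  also have "\<dots> \<le> (\<Sum>z\<in>S. \<bar>Q x z\<bar> * ?M ^ k)"
    by (intro sum_mono mult_left_mono Suc.IH) auto
  also have "\<dots> = (\<Sum>z\<in>S. \<bar>Q x z\<bar>) * ?M ^ k" by (simp add: sum_distrib_right)
  also have "\<dots> \<le> ?M * ?M ^ k"
    using assms(1) Suc.prems M
    by (intro mult_right_mono member_le_sum[where f = "\<lambda>w. \<Sum>z\<in>S. \<bar>Q w z\<bar>"]) (auto intro: sum_nonneg)
  finally show ?case by simp
qed

lemma summable_mat_exp:
  assumes "finite S" "x \<in> S"
  shows "summable (\<lambda>k. mat_pow S Q k x y / fact k * t ^ k)"
proof (rule summable_comparison_test')
  let ?M = "\<Sum>w\<in>S. \<Sum>z\<in>S. \<bar>Q w z\<bar>"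
  show "summable (\<lambda>k. inverse (fact k) * (?M * \<bar>t\<bar>) ^ k)" by (rule summable_exp)
  show "norm (mat_pow S Q k x y / fact k * t ^ k) \<le> inverse (fact k) * (?M * \<bar>t\<bar>) ^ k" for k
  proof -
    have "norm (mat_pow S Q k x y / fact k * t ^ k) = inverse (fact k) * (\<bar>mat_pow S Q k x y\<bar> * \<bar>t\<bar> ^ k)"
      by (simp add: abs_mult power_abs field_simps)
    also have "\<dots> \<le> inverse (fact k) * (?M ^ k * \<bar>t\<bar> ^ k)"
      by (intro mult_left_mono mult_right_mono abs_mat_pow_le assms) auto
    finally show ?thesis by (simp add: power_mult_distrib)
  qed
qed

text \<open>Separates the coefficients from the powers of \<open>t\<close>, the shape in which a
  power series is differentiated term by term.\<close>

lemma ctmc_trans_powser: "ctmc_trans S Q t x y = (\<Sum>k. mat_pow S Q k x y / fact k * t ^ k)"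
  unfolding ctmc_trans_def by (rule suminf_cong) simp

lemma ctmc_trans_0 [simp]: "ctmc_trans S Q 0 x y = (if x = y then 1 else 0)"
  unfolding ctmc_trans_powser by (subst powser_zero) simp

lemma ctmc_trans_deriv_powser:
  assumes "finite S" "x \<in> S"
  shows "((\<lambda>t. ctmc_trans S Q t x y) has_real_derivative
           (\<Sum>k. mat_pow S Q (Suc k) x y / fact k * t ^ k)) (at t)"
proof -
  have "diffs (\<lambda>k. mat_pow S Q k x y / fact k) k = mat_pow S Q (Suc k) x y / fact k" for k
    unfolding diffs_def fact_Suc by (simp del: mat_pow.simps of_nat_Suc)
  then show ?thesis
    using termdiffs_strong_converges_everywhere[OF summable_mat_exp[OF assms, of Q y], of t]
    unfolding ctmc_trans_powser by (simp del: mat_pow.simps)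
qed

text \<open>Kolmogorov's backward equation: differentiation shifts the coefficients by one index,
  and the extra factor \<open>Q\<close> is split off on the left.\<close>

lemma ctmc_trans_backward:
  assumes "finite S" "x \<in> S"
  shows "((\<lambda>t. ctmc_trans S Q t x y) has_real_derivative
           (\<Sum>z\<in>S. Q x z * ctmc_trans S Q t z y)) (at t)"
proof -
  have "(\<Sum>z\<in>S. Q x z * ctmc_trans S Q t z y)
      = (\<Sum>z\<in>S. \<Sum>k. Q x z * (mat_pow S Q k z y / fact k * t ^ k))"
    unfolding ctmc_trans_powser using assms
    by (intro sum.cong refl suminf_mult[symmetric] summable_mat_exp) auto
  also have "\<dots> = (\<Sum>k. \<Sum>z\<in>S. Q x z * (mat_pow S Q k z y / fact k * t ^ k))"
    using assms by (intro suminf_sum[symmetric] summable_mult summable_mat_exp) auto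
  also have "\<dots> = (\<Sum>k. mat_pow S Q (Suc k) x y / fact k * t ^ k)"
    by (simp add: sum_distrib_right sum_divide_distrib mult.assoc)
  finally show ?thesis using ctmc_trans_deriv_powser[OF assms, of Q y t] by simp
qed

text \<open>Kolmogorov's forward equation, with the extra factor split off on the right.
  Expectations under the chain are differentiated through it.\<close>

lemma ctmc_trans_forward:
  assumes "finite S" "x \<in> S" "y \<in> S"
  shows "((\<lambda>t. ctmc_trans S Q t x y) has_real_derivative
           (\<Sum>z\<in>S. ctmc_trans S Q t x z * Q z y)) (at t)"
proof -
  have "(\<Sum>z\<in>S. ctmc_trans S Q t x z * Q z y)
      = (\<Sum>z\<in>S. \<Sum>k. mat_pow S Q k x z / fact k * t ^ k * Q z y)"
    unfolding ctmc_trans_powser using assms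
    by (intro sum.cong refl suminf_mult2 summable_mat_exp) auto
  also have "\<dots> = (\<Sum>k. \<Sum>z\<in>S. mat_pow S Q k x z / fact k * t ^ k * Q z y)"
    using assms by (intro suminf_sum[symmetric] summable_mult2 summable_mat_exp) auto
  also have "\<dots> = (\<Sum>k. mat_pow S Q (Suc k) x y / fact k * t ^ k)"
    unfolding mat_pow_Suc_right[OF assms]
    by (simp add: sum_distrib_left sum_distrib_right sum_divide_distrib mult_ac)
  finally show ?thesis using ctmc_trans_deriv_powser[OF assms(1,2), of Q y t] by simp
qed

lemma mat_pow_nonneg:
  assumes "\<And>x y. x \<in> S \<Longrightarrow> y \<in> S \<Longrightarrow> Q x y \<ge> 0" "x \<in> S"
  shows "mat_pow S Q k x y \<ge> 0"
  using assms(2) by (induction k arbitrary: x) (auto intro!: sum_nonneg mult_nonneg_nonneg assms(1))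

lemma ctmc_trans_nonneg_of_nonneg:
  assumes "finite S" "\<And>x y. x \<in> S \<Longrightarrow> y \<in> S \<Longrightarrow> Q x y \<ge> 0" "x \<in> S" "t \<ge> 0"
  shows "ctmc_trans S Q t x y \<ge> 0"
  unfolding ctmc_trans_powser using assms
  by (intro suminf_nonneg summable_mat_exp) (auto intro!: mult_nonneg_nonneg divide_nonneg_nonneg mat_pow_nonneg)

text \<open>Uniformisation: adding a large multiple \<open>C\<close> of the identity makes \<open>Q\<close> entrywise nonnegative,
  and \<open>exp (t Q) = exp (- C t) exp (t (Q + C))\<close>; the latter identity holds because
  \<open>s \<mapsto> exp (s Q) exp (- C (T - s)) exp ((T - s) (Q + C))\<close> has zero derivative.\<close>

lemma ctmc_trans_nonneg:
  assumes fin: "finite S" and Q: "\<And>x y. x \<in> S \<Longrightarrow> y \<in> S \<Longrightarrow> x \<noteq> y \<Longrightarrow> Q x y \<ge> 0"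
    and xy: "x \<in> S" "y \<in> S" and T: "T \<ge> 0"
  shows "ctmc_trans S Q T x y \<ge> 0"
proof -
  define C where "C = (\<Sum>x\<in>S. \<bar>Q x x\<bar>)"
  define R where "R = (\<lambda>x y. Q x y + (if x = y then C else 0))"
  define h where "h = (\<lambda>s. \<Sum>z\<in>S. ctmc_trans S Q s x z * (exp (- C * (T - s)) * ctmc_trans S R (T - s) z y))"
  have R: "R x y \<ge> 0" if "x \<in> S" "y \<in> S" for x y
  proof -
    have "\<bar>Q x x\<bar> \<le> C" unfolding C_def using that fin
      by (intro member_le_sum[where f = "\<lambda>x. \<bar>Q x x\<bar>"]) auto
    then show ?thesis using that Q[of x y] by (auto simp: R_def)
  qed
  have "DERIV h s :> 0" for s
  proof -
    let ?P = "\<lambda>z. ctmc_trans S Q s x z" and ?e = "exp (- C * (T - s))"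
    let ?W = "\<lambda>z. ctmc_trans S R (T - s) z y"
    have d: "((\<lambda>s. ctmc_trans S Q s x z * (exp (- C * (T - s)) * ctmc_trans S R (T - s) z y))
        has_real_derivative (\<Sum>w\<in>S. ?P w * Q w z) * (?e * ?W z)
           + ?P z * (?e * C * ?W z - ?e * (\<Sum>w\<in>S. R z w * ?W w))) (at s)" if z: "z \<in> S" for z
    proof -
      have W: "((\<lambda>s. ctmc_trans S R (T - s) z y) has_real_derivative (\<Sum>w\<in>S. R z w * ?W w) * (-1)) (at s)"
        by (rule DERIV_chain2[OF ctmc_trans_backward[OF fin z]]) (auto intro!: derivative_eq_intros)
      have E: "((\<lambda>s. exp (- C * (T - s))) has_real_derivative ?e * C) (at s)"
        by (auto intro!: derivative_eq_intros)
      show ?thesis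
        using DERIV_mult[OF ctmc_trans_forward[OF fin xy(1) z, of Q s] DERIV_mult[OF E W]]
        by (rule DERIV_cong) (simp add: algebra_simps)
    qed
    have RW: "(\<Sum>w\<in>S. R z w * ?W w) = (\<Sum>w\<in>S. Q z w * ?W w) + C * ?W z" if "z \<in> S" for z
    proof -
      have "(\<Sum>w\<in>S. R z w * ?W w) = (\<Sum>w\<in>S. Q z w * ?W w + (if z = w then C * ?W w else 0))"
        by (intro sum.cong) (auto simp: R_def algebra_simps)
      then show ?thesis using fin that by (simp add: sum.distrib)
    qed
    \<comment> \<open>By \<open>RW\<close> the terms with \<open>C\<close> cancel, and what remains
      is the product of \<open>?P\<close>, \<open>Q\<close> and \<open>?W\<close> summed in two
      orders.\<close>
    have "(\<Sum>z\<in>S. (\<Sum>w\<in>S. ?P w * Q w z) * (?e * ?W z)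
           + ?P z * (?e * C * ?W z - ?e * (\<Sum>w\<in>S. R z w * ?W w)))
        = (\<Sum>z\<in>S. \<Sum>w\<in>S. ?e * (?P w * Q w z * ?W z)) - (\<Sum>z\<in>S. \<Sum>w\<in>S. ?e * (?P z * Q z w * ?W w))"
      unfolding sum_subtractf[symmetric] 
      by (intro sum.cong refl) (simp add: RW algebra_simps sum_distrib_left sum_distrib_right sum_subtractf)
    also have "\<dots> = 0" using sum.swap[of "\<lambda>z w. ?e * (?P w * Q w z * ?W z)" S S] by simp
    finally have 0: "(\<Sum>z\<in>S. (\<Sum>w\<in>S. ?P w * Q w z) * (?e * ?W z)
           + ?P z * (?e * C * ?W z - ?e * (\<Sum>w\<in>S. R z w * ?W w))) = 0" .
    show ?thesis
      unfolding h_def 0[symmetric] by (intro DERIV_sum d)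
  qed
  then have "h T = h 0" by (intro DERIV_isconst_all) auto
  moreover have "h 0 = exp (- C * T) * ctmc_trans S R T x y"
    using fin xy by (simp add: h_def if_distrib[of "\<lambda>u. u * _"] cong: if_cong)
  moreover have "h T = ctmc_trans S Q T x y"
    using fin xy by (simp add: h_def if_distrib[of "\<lambda>u. _ * u"] cong: if_cong)
  moreover have "ctmc_trans S R T x y \<ge> 0"
    by (rule ctmc_trans_nonneg_of_nonneg[OF fin R xy(1) T])
  ultimately show ?thesis by simp
qed

text \<open>By the forward equation the derivative of the row sum contains the row sums of
  \<open>Q\<close>, which vanish; at time 0 the row sum is 1.\<close>

lemma ctmc_trans_row_sum:
  assumes fin: "finite S" and Q0: "\<And>x. x \<in> S \<Longrightarrow> (\<Sum>y\<in>S. Q x y) = 0" and x: "x \<in> S"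
  shows "(\<Sum>y\<in>S. ctmc_trans S Q T x y) = 1"
proof -
  have "DERIV (\<lambda>s. \<Sum>y\<in>S. ctmc_trans S Q s x y) s :> 0" for s
  proof -
    have "(\<Sum>y\<in>S. \<Sum>z\<in>S. ctmc_trans S Q s x z * Q z y) = 0"
      by (subst sum.swap, subst sum_distrib_left[symmetric]) (simp add: Q0)
    moreover have "DERIV (\<lambda>s. \<Sum>y\<in>S. ctmc_trans S Q s x y) s
        :> (\<Sum>y\<in>S. \<Sum>z\<in>S. ctmc_trans S Q s x z * Q z y)"
      by (intro DERIV_sum ctmc_trans_forward fin x)
    ultimately show ?thesis by simp
  qed
  then have "(\<Sum>y\<in>S. ctmc_trans S Q T x y) = (\<Sum>y\<in>S. ctmc_trans S Q 0 x y)"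
    by (intro DERIV_isconst_all) auto
  then show ?thesis using fin x by simp
qed

text \<open>Dynkin's formula as an inequality, for a function that also depends on time. The
  derivative of its expectation is the expectation of time derivative plus generator, and the
  transition weights form a probability vector, so a drift bound valid at every state integrates to
  \<open>\<kappa> * T\<close>.\<close>

lemma ctmc_drift_inequality:
  fixes \<Phi> \<Phi>' :: "real \<Rightarrow> 's \<Rightarrow> real"
  assumes fin: "finite S" and Q: "\<And>x y. x \<in> S \<Longrightarrow> y \<in> S \<Longrightarrow> x \<noteq> y \<Longrightarrow> Q x y \<ge> 0"
    and Q0: "\<And>x. x \<in> S \<Longrightarrow> (\<Sum>y\<in>S. Q x y) = 0"
    and x: "x \<in> S" and T: "T \<ge> 0"
    and deriv: "\<And>s y. 0 \<le> s \<Longrightarrow> y \<in> S \<Longrightarrow> ((\<lambda>s. \<Phi> s y) has_real_derivative \<Phi>' s y) (at s)"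
    and drift: "\<And>s y. 0 \<le> s \<Longrightarrow> y \<in> S \<Longrightarrow> \<Phi>' s y + (\<Sum>z\<in>S. Q y z * \<Phi> s z) \<le> \<kappa>"
  shows "(\<Sum>y\<in>S. ctmc_trans S Q T x y * \<Phi> T y) \<le> \<Phi> 0 x + \<kappa> * T"
proof -
  let ?P = "\<lambda>s y. ctmc_trans S Q s x y"
  define g where "g = (\<lambda>s. (\<Sum>y\<in>S. ?P s y * \<Phi> s y) - \<kappa> * s)"
  have "g 0 \<ge> g T"
  proof (rule DERIV_nonpos_imp_nonincreasing[OF T])
    fix s assume s: "0 \<le> s" "s \<le> T"
    let ?d = "(\<Sum>y\<in>S. (\<Sum>z\<in>S. ?P s z * Q z y) * \<Phi> s y + \<Phi>' s y * ?P s y) - \<kappa> * 1"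
    have "DERIV g s :> ?d"
      unfolding g_def
      by (intro DERIV_diff DERIV_sum DERIV_mult DERIV_cmult DERIV_ident ctmc_trans_forward deriv fin x s)
    moreover have "?d \<le> 0"
    proof -
      have "(\<Sum>y\<in>S. \<Sum>z\<in>S. ?P s z * Q z y * \<Phi> s y) = (\<Sum>y\<in>S. \<Sum>z\<in>S. ?P s y * Q y z * \<Phi> s z)"
        by (rule sum.swap)
      then have "(\<Sum>y\<in>S. (\<Sum>z\<in>S. ?P s z * Q z y) * \<Phi> s y + \<Phi>' s y * ?P s y)
          = (\<Sum>y\<in>S. ?P s y * (\<Phi>' s y + (\<Sum>z\<in>S. Q y z * \<Phi> s z)))"
        by (simp add: sum.distrib sum_distrib_left sum_distrib_right distrib_left mult_ac)
      also have "\<dots> \<le> (\<Sum>y\<in>S. ?P s y * \<kappa>)"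
        using s by (intro sum_mono mult_left_mono drift ctmc_trans_nonneg fin Q x) auto
      also have "\<dots> = \<kappa>" using ctmc_trans_row_sum[OF fin Q0 x, where T = s]
        by (simp flip: sum_distrib_right)
      finally show ?thesis by simp
    qed
    ultimately show "\<exists>y. DERIV g s :> y \<and> y \<le> 0" by blast
  qed
  moreover have "g 0 = \<Phi> 0 x"
    using fin x by (simp add: g_def if_distrib[of "\<lambda>u. u * _"] cong: if_cong)
  ultimately show ?thesis by (simp add: g_def)
qed

section \<open>The generator of the Glauber dynamics\<close>

lemma finite_configs [simp]: "finite (configs N)"
  unfolding configs_def by (intro finite_PiE) auto

lemma configs_values:
  assumes "\<sigma> \<in> configs N" "u < N"
  shows "\<sigma> u = 1 \<or> \<sigma> u = -1"
  using assms unfolding configs_def by (auto dest!: PiE_mem[of _ _ _ u])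

lemma abs_configs [simp]:
  assumes "\<sigma> \<in> configs N" "u < N"
  shows "\<bar>\<sigma> u\<bar> = 1"
  using configs_values[OF assms] by auto

lemma flip_in_configs:
  assumes "\<sigma> \<in> configs N" "u < N"
  shows "flip \<sigma> u \<in> configs N"
  using assms configs_values[OF assms] unfolding configs_def flip_def
  by (fastforce intro!: PiE_I dest: PiE_mem PiE_arb)

lemma flip_neq:
  assumes "\<sigma> \<in> configs N" "u < N"
  shows "flip \<sigma> u \<noteq> \<sigma>"
proof
  assume "flip \<sigma> u = \<sigma>"
  then have "- \<sigma> u = \<sigma> u" by (metis flip_def fun_upd_same)
  then show False using configs_values[OF assms] by auto
qed

lemma flip_rate_bounds: "0 \<le> flip_rate \<beta> x" "flip_rate \<beta> x \<le> 1"
  unfolding flip_rate_def by (auto intro!: add_nonneg_nonneg simp: add_pos_pos)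

lemma generator_nonneg: "\<sigma> \<noteq> \<sigma>' \<Longrightarrow> generator N E alph \<beta> \<sigma> \<sigma>' \<ge> 0"
  unfolding generator_def by (auto intro!: sum_nonneg flip_rate_bounds)

text \<open>After exchanging the sums, each node contributes to exactly one target, because its flip
  is again a configuration and differs from \<open>\<sigma>\<close>.\<close>

lemma generator_apply:
  assumes \<sigma>: "\<sigma> \<in> configs N"
  shows "(\<Sum>\<sigma>'\<in>configs N. generator N E alph \<beta> \<sigma> \<sigma>' * f \<sigma>') =
         (\<Sum>u<N. flip_rate \<beta> (Delta N E alph \<sigma> u) * (f (flip \<sigma> u) - f \<sigma>))"
proof -
  let ?r = "\<lambda>u. flip_rate \<beta> (Delta N E alph \<sigma> u)"
  have "(\<Sum>\<sigma>'\<in>configs N - {\<sigma>}. generator N E alph \<beta> \<sigma> \<sigma>' * f \<sigma>')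
      = (\<Sum>\<sigma>'\<in>configs N - {\<sigma>}. \<Sum>u<N. if flip \<sigma> u = \<sigma>' then ?r u * f \<sigma>' else 0)"
  proof (intro sum.cong refl)
    fix \<sigma>' assume "\<sigma>' \<in> configs N - {\<sigma>}"
    then have "generator N E alph \<beta> \<sigma> \<sigma>' * f \<sigma>' = (\<Sum>u\<in>{u\<in>{..<N}. flip \<sigma> u = \<sigma>'}. ?r u * f \<sigma>')"
      by (auto simp: generator_def sum_distrib_right intro!: sum.cong)
    also have "\<dots> = (\<Sum>u<N. if flip \<sigma> u = \<sigma>' then ?r u * f \<sigma>' else 0)"
      by (rule sum.inter_filter) simp
    finally show "generator N E alph \<beta> \<sigma> \<sigma>' * f \<sigma>' = \<dots>" .
  qed
  also have "\<dots> = (\<Sum>u<N. \<Sum>\<sigma>'\<in>configs N - {\<sigma>}. if flip \<sigma> u = \<sigma>' then ?r u * f \<sigma>' else 0)"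
    by (rule sum.swap)
  also have "\<dots> = (\<Sum>u<N. ?r u * f (flip \<sigma> u))"
    using flip_in_configs[OF \<sigma>] flip_neq[OF \<sigma>] by (intro sum.cong refl) simp
  finally have "(\<Sum>\<sigma>'\<in>configs N. generator N E alph \<beta> \<sigma> \<sigma>' * f \<sigma>')
      = generator N E alph \<beta> \<sigma> \<sigma> * f \<sigma> + (\<Sum>u<N. ?r u * f (flip \<sigma> u))"
    using \<sigma> by (simp add: sum.remove)
  then show ?thesis
    by (simp add: generator_def right_diff_distrib sum_subtractf sum_distrib_right)
qed

lemma generator_row_sum:
  assumes "\<sigma> \<in> configs N"
  shows "(\<Sum>\<sigma>'\<in>configs N. generator N E alph \<beta> \<sigma> \<sigma>') = 0"
  using generator_apply[OF assms, of E alph \<beta> "\<lambda>_. 1"] by simp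

section \<open>Uniform concentration of the random graph\<close>

lemma exp_le_quadratic:
  fixes x :: real
  assumes "\<bar>x\<bar> \<le> 1"
  shows "exp x \<le> 1 + x + x\<^sup>2"
proof (cases "x \<ge> 0")
  case True
  then show ?thesis using exp_bound assms by auto
next
  case False
  \<comment> \<open>The product is \<open>1 - x ^ 3\<close>, and \<open>x\<close> is negative
    here.\<close>
  have "1 \<le> (1 + x + x\<^sup>2) * (1 - x)"
    using False by (simp add: algebra_simps power2_eq_square mult_nonneg_nonpos zero_le_mult_iff mult_le_0_iff)
  also have "\<dots> \<le> (1 + x + x\<^sup>2) * exp (- x)"
    using exp_ge_add_one_self[of "- x"] assms by (intro mult_left_mono) auto
  finally show ?thesis by (simp add: exp_minus field_simps)
qed

text \<open>Factor out \<open>exp (- \<theta> * q)\<close>, then use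
  \<open>1 + y \<le> exp y\<close> and the quadratic bound for \<open>exp \<theta>\<close>. The
  exponent keeps the factor \<open>q\<close>, which gives sparse graphs fluctuations of order
  \<open>n * sqrt \<lambda>\<close>. The form \<open>0 - q\<close> matches an edge indicator with
  value 0.\<close>

lemma centred_bernoulli_mgf_le:
  fixes q \<theta> :: real
  assumes "0 \<le> q" "q \<le> 1" "\<bar>\<theta>\<bar> \<le> 1"
  shows "q * exp (\<theta> * (1 - q)) + (1 - q) * exp (\<theta> * (0 - q)) \<le> exp (q * \<theta>\<^sup>2)"
proof -
  have "q * exp (\<theta> * (1 - q)) + (1 - q) * exp (\<theta> * (0 - q)) = exp (- \<theta> * q) * (1 + q * (exp \<theta> - 1))"
    by (simp add: right_diff_distrib distrib_left exp_diff exp_minus field_simps)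
  also have "\<dots> \<le> exp (- \<theta> * q) * exp (q * (exp \<theta> - 1))"
    by (intro mult_left_mono exp_ge_add_one_self) auto
  also have "\<dots> = exp (q * (exp \<theta> - 1 - \<theta>))"
    by (simp add: exp_add[symmetric] algebra_simps)
  also have "\<dots> \<le> exp (q * \<theta>\<^sup>2)"
    using exp_le_quadratic[OF assms(3)] assms(1) by (auto intro!: mult_left_mono)
  finally show ?thesis .
qed

lemma finite_pairs [simp]: "finite (pairs N)"
  by (rule finite_subset[of _ "{..<N} \<times> {..<N}"]) (auto simp: pairs_def)

lemma card_pairs_le: "card (pairs N) \<le> N\<^sup>2"
proof -
  have "card (pairs N) \<le> card ({..<N} \<times> {..<N})"
    by (intro card_mono) (auto simp: pairs_def)
  then show ?thesis by (simp add: power2_eq_square)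
qed

text \<open>Row \<open>u\<close> of the centred adjacency matrix, applied to
  \<open>\<sigma>\<close>. The diagonal is left out since there are no loops, while
  \<open>edge_prob\<close> at \<open>(u, u)\<close> would be \<open>pin\<close>.\<close>

definition noise :: "nat \<Rightarrow> nat \<Rightarrow> real \<Rightarrow> real \<Rightarrow> (nat \<times> nat) set \<Rightarrow> (nat \<Rightarrow> real) \<Rightarrow> nat \<Rightarrow> real" where
  "noise N V1 pin pout E \<sigma> u =
     (\<Sum>v\<in>{0..<N} - {u}. ((if adj E u v then 1 else 0) - edge_prob V1 pin pout (u, v)) * \<sigma> v)"

lemma sum_off_diagonal:
  fixes F :: "nat \<Rightarrow> nat \<Rightarrow> real"
  shows "(\<Sum>u<N. \<Sum>v\<in>{0..<N} - {u}. F u v) = (\<Sum>p\<in>pairs N. F (fst p) (snd p) + F (snd p) (fst p))"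
proof -
  have "(\<Sum>u<N. \<Sum>v\<in>{0..<N} - {u}. F u v) = (\<Sum>p\<in>(SIGMA u:{..<N}. {0..<N} - {u}). F (fst p) (snd p))"
    by (subst sum.Sigma) (auto simp: case_prod_unfold)
  also have "(SIGMA u:{..<N}. {0..<N} - {u}) = pairs N \<union> prod.swap ` pairs N"
    by (auto simp: pairs_def image_iff) 
  also have "(\<Sum>p\<in>pairs N \<union> prod.swap ` pairs N. F (fst p) (snd p))
      = (\<Sum>p\<in>pairs N. F (fst p) (snd p)) + (\<Sum>p\<in>prod.swap ` pairs N. F (fst p) (snd p))"
    by (intro sum.union_disjoint finite_imageI finite_pairs) (auto simp: pairs_def)
  also have "(\<Sum>p\<in>prod.swap ` pairs N. F (fst p) (snd p)) = (\<Sum>p\<in>pairs N. F (snd p) (fst p))"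
    by (subst sum.reindex) (auto simp: inj_on_def)
  finally show ?thesis by (simp add: sum.distrib)
qed

text \<open>Both orientations of a pair share one edge indicator and one probability. Collecting
  them leaves a sum of independent centred variables, one for each unordered pair.\<close>

lemma noise_bilinear_form:
  "(\<Sum>u<N. x u * noise N V1 pin pout E \<sigma> u) =
   (\<Sum>p\<in>pairs N. (x (fst p) * \<sigma> (snd p) + x (snd p) * \<sigma> (fst p)) *
      ((if p \<in> E then 1 else 0) - edge_prob V1 pin pout p))"
proof -
  let ?d = "\<lambda>u v. (if adj E u v then 1 else 0) - edge_prob V1 pin pout (u, v)"
  have "(\<Sum>u<N. x u * noise N V1 pin pout E \<sigma> u)
      = (\<Sum>u<N. \<Sum>v\<in>{0..<N} - {u}. x u * ?d u v * \<sigma> v)"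
    by (simp add: noise_def sum_distrib_left mult.assoc)
  also have "\<dots> = (\<Sum>p\<in>pairs N. x (fst p) * ?d (fst p) (snd p) * \<sigma> (snd p)
                               + x (snd p) * ?d (snd p) (fst p) * \<sigma> (fst p))"
    by (rule sum_off_diagonal)
  also have "\<dots> = (\<Sum>p\<in>pairs N. (x (fst p) * \<sigma> (snd p) + x (snd p) * \<sigma> (fst p)) *
      ((if p \<in> E then 1 else 0) - edge_prob V1 pin pout p))"
    by (intro sum.cong) (auto simp: pairs_def adj_def edge_prob_def algebra_simps)
  finally show ?thesis .
qed

text \<open>Independence of the edges: expanding a product of two-term sums over all subsets of the
  index set recovers the expectation of a product.\<close>

lemma graph_prob_expectation_prod:
  "(\<Sum>E\<in>Pow (pairs N). graph_prob N V1 pin pout E * (\<Prod>p\<in>pairs N. if p \<in> E then f p else g p)) =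
   (\<Prod>p\<in>pairs N. edge_prob V1 pin pout p * f p + (1 - edge_prob V1 pin pout p) * g p)"
proof -
  let ?q = "edge_prob V1 pin pout"
  have "graph_prob N V1 pin pout E * (\<Prod>p\<in>pairs N. if p \<in> E then f p else g p)
      = (\<Prod>p\<in>E. ?q p * f p) * (\<Prod>p\<in>pairs N - E. (1 - ?q p) * g p)" if "E \<subseteq> pairs N" for E
  proof -
    have "graph_prob N V1 pin pout E * (\<Prod>p\<in>pairs N. if p \<in> E then f p else g p)
        = (\<Prod>p\<in>pairs N. if p \<in> E then ?q p * f p else (1 - ?q p) * g p)"
      unfolding graph_prob_def prod.distrib[symmetric] by (intro prod.cong) auto
    also have "\<dots> = (\<Prod>p\<in>pairs N - E. if p \<in> E then ?q p * f p else (1 - ?q p) * g p)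
                   * (\<Prod>p\<in>E. if p \<in> E then ?q p * f p else (1 - ?q p) * g p)"
      using that by (intro prod.subset_diff) auto
    finally show ?thesis by (simp add: mult.commute)
  qed
  then show ?thesis by (simp add: prod_add)
qed

lemma graph_prob_sum: "(\<Sum>E\<in>Pow (pairs N). graph_prob N V1 pin pout E) = 1"
  using graph_prob_expectation_prod[of N V1 pin pout "\<lambda>_. 1" "\<lambda>_. 1"] by (simp cong: if_cong)

lemma edge_prob_bounds:
  assumes "0 \<le> pin" "pin \<le> q" "0 \<le> pout" "pout \<le> q"
  shows "0 \<le> edge_prob V1 pin pout p" "edge_prob V1 pin pout p \<le> q"
  using assms by (auto simp: edge_prob_def)

lemma graph_prob_nonneg:
  assumes "0 \<le> pin" "pin \<le> 1" "0 \<le> pout" "pout \<le> 1"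
  shows "graph_prob N V1 pin pout E \<ge> 0"
  unfolding graph_prob_def using edge_prob_bounds[OF assms] by (intro prod_nonneg) auto

text \<open>By independence the moment generating function factorises over pairs. The coefficient of
  a pair is at most \<open>2 * \<theta>\<close> in modulus, hence at most 1 as the Bernoulli bound
  demands; there are at most \<open>N ^ 2\<close> pairs.\<close>

lemma noise_bilinear_form_mgf_le:
  assumes p: "0 \<le> pin" "pin \<le> q" "0 \<le> pout" "pout \<le> q" "q \<le> 1"
    and \<theta>: "0 \<le> \<theta>" "\<theta> \<le> 1/2"
    and x: "x \<in> configs N" and y: "y \<in> configs N"
  shows "(\<Sum>E\<in>Pow (pairs N). graph_prob N V1 pin pout E *
            exp (\<theta> * (\<Sum>u<N. x u * noise N V1 pin pout E y u))) \<le> exp (4 * \<theta>\<^sup>2 * q * real N ^ 2)"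
proof -
  let ?q = "edge_prob V1 pin pout"
  define c where "c p = \<theta> * (x (fst p) * y (snd p) + x (snd p) * y (fst p))" for p
  have c: "\<bar>c p\<bar> \<le> 2 * \<theta>" if "p \<in> pairs N" for p
  proof -
    have "fst p < N" "snd p < N" using that by (auto simp: pairs_def)
    then have "\<bar>x (fst p) * y (snd p) + x (snd p) * y (fst p)\<bar> \<le> 2"
      using abs_triangle_ineq[of "x (fst p) * y (snd p)" "x (snd p) * y (fst p)"] x y
      by (simp add: abs_mult)
    then show ?thesis using \<theta> unfolding c_def
      by (simp add: abs_mult mult_left_mono mult.commute[of 2])
  qed
  have "exp (\<theta> * (\<Sum>u<N. x u * noise N V1 pin pout E y u))
      = (\<Prod>p\<in>pairs N. if p \<in> E then exp (c p * (1 - ?q p)) else exp (c p * (0 - ?q p)))" for E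
    unfolding noise_bilinear_form sum_distrib_left exp_sum[OF finite_pairs]
    by (intro prod.cong) (auto simp: c_def mult.assoc)
  then have "(\<Sum>E\<in>Pow (pairs N). graph_prob N V1 pin pout E *
            exp (\<theta> * (\<Sum>u<N. x u * noise N V1 pin pout E y u)))
      = (\<Prod>p\<in>pairs N. ?q p * exp (c p * (1 - ?q p)) + (1 - ?q p) * exp (c p * (0 - ?q p)))"
    by (simp only: graph_prob_expectation_prod)
  also have "\<dots> \<le> (\<Prod>p\<in>pairs N. exp (4 * \<theta>\<^sup>2 * q))"
  proof (intro prod_mono conjI)
    fix p assume p': "p \<in> pairs N"
    note q = edge_prob_bounds[OF p(1-4), of V1 p]
    show "0 \<le> ?q p * exp (c p * (1 - ?q p)) + (1 - ?q p) * exp (c p * (0 - ?q p))"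
      using q p by (intro add_nonneg_nonneg mult_nonneg_nonneg) auto
    have "?q p * exp (c p * (1 - ?q p)) + (1 - ?q p) * exp (c p * (0 - ?q p)) \<le> exp (?q p * (c p)\<^sup>2)"
      using q p c[OF p'] \<theta> by (intro centred_bernoulli_mgf_le) auto
    also have "?q p * (c p)\<^sup>2 \<le> q * (2 * \<theta>)\<^sup>2"
      using q power_mono[OF c[OF p'], of 2] by (intro mult_mono) auto
    then have "exp (?q p * (c p)\<^sup>2) \<le> exp (4 * \<theta>\<^sup>2 * q)"
      by (simp add: power_mult_distrib mult_ac)
    finally show "?q p * exp (c p * (1 - ?q p)) + (1 - ?q p) * exp (c p * (0 - ?q p)) \<le> exp (4 * \<theta>\<^sup>2 * q)" .
  qed
  also have "\<dots> = exp (4 * \<theta>\<^sup>2 * q * real (card (pairs N)))"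
    by (simp add: exp_of_nat_mult[symmetric] mult_ac)
  also have "\<dots> \<le> exp (4 * \<theta>\<^sup>2 * q * real N ^ 2)"
    using p card_pairs_le[of N] by (simp add: mult_left_mono flip: of_nat_power)
  finally show ?thesis .
qed

lemma card_configs: "card (configs N) = 2 ^ N"
  unfolding configs_def by (subst card_PiE) (auto simp: numeral_2_eq_2)

text \<open>Taking for \<open>x\<close> the sign pattern of the noise turns its \<open>\<ell>\<^sub>1\<close> norm into a bilinear form,
  so a union bound over pairs of sign vectors controls it for all configurations at once.\<close>

lemma graph_prob_large_noise_le:
  assumes p: "0 \<le> pin" "pin \<le> q" "0 \<le> pout" "pout \<le> q" "q \<le> 1"
    and \<theta>: "0 \<le> \<theta>" "\<theta> \<le> 1/2"
  shows "(\<Sum>E\<in>{E \<in> Pow (pairs N). \<exists>\<sigma>\<in>configs N. (\<Sum>u<N. \<bar>noise N V1 pin pout E \<sigma> u\<bar>) > s}.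
            graph_prob N V1 pin pout E) \<le> 4 ^ N * exp (4 * \<theta>\<^sup>2 * q * real N ^ 2 - \<theta> * s)"
proof -
  let ?B = "{E \<in> Pow (pairs N). \<exists>\<sigma>\<in>configs N. (\<Sum>u<N. \<bar>noise N V1 pin pout E \<sigma> u\<bar>) > s}"
  let ?P = "graph_prob N V1 pin pout"
  let ?X = "\<lambda>E x y. exp (\<theta> * (\<Sum>u<N. x u * noise N V1 pin pout E y u))"
  have P: "?P E \<ge> 0" for E using p by (intro graph_prob_nonneg) auto
  \<comment> \<open>The indicator of a bad graph is dominated by an exponential sum, since a single
    one of its terms already exceeds \<open>exp (\<theta> * s)\<close>.\<close>
  have one: "1 \<le> (\<Sum>x\<in>configs N. \<Sum>y\<in>configs N. ?X E x y) * exp (- \<theta> * s)" if "E \<in> ?B" for E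
  proof -
    from that obtain y where y: "y \<in> configs N" "(\<Sum>u<N. \<bar>noise N V1 pin pout E y u\<bar>) > s" by auto
    define x where "x = (\<lambda>u\<in>{0..<N}. if noise N V1 pin pout E y u \<ge> 0 then 1 else (-1::real))"
    have x: "x \<in> configs N" by (auto simp: x_def configs_def)
    have "(\<Sum>u<N. x u * noise N V1 pin pout E y u) = (\<Sum>u<N. \<bar>noise N V1 pin pout E y u\<bar>)"
      by (intro sum.cong) (auto simp: x_def)
    then have "1 \<le> ?X E x y * exp (- \<theta> * s)"
      using y(2) \<theta> by (simp add: exp_add[symmetric] mult_left_mono)
    also have "?X E x y \<le> (\<Sum>y\<in>configs N. ?X E x y)"
      using y by (intro member_le_sum[where f = "?X E x"]) auto
    also have "\<dots> \<le> (\<Sum>x\<in>configs N. \<Sum>y\<in>configs N. ?X E x y)"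
      using x by (intro member_le_sum[where f = "\<lambda>x. \<Sum>y\<in>configs N. ?X E x y"] sum_nonneg) auto
    finally show ?thesis by simp
  qed
  have "sum ?P ?B \<le> (\<Sum>E\<in>?B. ?P E * ((\<Sum>x\<in>configs N. \<Sum>y\<in>configs N. ?X E x y) * exp (- \<theta> * s)))"
    using mult_left_mono[OF one P] by (intro sum_mono) simp
  also have "\<dots> \<le> (\<Sum>E\<in>Pow (pairs N). ?P E * ((\<Sum>x\<in>configs N. \<Sum>y\<in>configs N. ?X E x y) * exp (- \<theta> * s)))"
    by (intro sum_mono2 mult_nonneg_nonneg P sum_nonneg) auto
  also have "\<dots> = (\<Sum>E\<in>Pow (pairs N). \<Sum>x\<in>configs N. \<Sum>y\<in>configs N. ?P E * ?X E x y) * exp (- \<theta> * s)"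
    by (simp add: sum_distrib_left sum_distrib_right mult.assoc)
  also have "(\<Sum>E\<in>Pow (pairs N). \<Sum>x\<in>configs N. \<Sum>y\<in>configs N. ?P E * ?X E x y)
      = (\<Sum>x\<in>configs N. \<Sum>y\<in>configs N. \<Sum>E\<in>Pow (pairs N). ?P E * ?X E x y)"
    by (subst sum.swap, intro sum.cong refl, rule sum.swap)
  also have "\<dots> \<le> (\<Sum>x\<in>configs N. \<Sum>y\<in>configs N. exp (4 * \<theta>\<^sup>2 * q * real N ^ 2))"
    by (intro sum_mono noise_bilinear_form_mgf_le p \<theta>)
  also have "\<dots> = 4 ^ N * exp (4 * \<theta>\<^sup>2 * q * real N ^ 2)"
    by (simp add: card_configs flip: power_mult_distrib mult.assoc)
  finally show ?thesis by (simp add: exp_diff exp_minus field_simps)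
qed

section \<open>The initial configuration\<close>

definition label :: "nat \<Rightarrow> nat \<Rightarrow> real" where
  "label V1 u = (if u < V1 then 1 else -1)"

lemma label_cases: "label V1 u = 1 \<or> label V1 u = -1"
  by (simp add: label_def)

definition init_weight :: "nat \<Rightarrow> real \<Rightarrow> nat \<Rightarrow> real \<Rightarrow> real" where
  "init_weight V1 \<eta> u y = \<eta> * (if y = label V1 u then 1 else 0) + (1 - \<eta>) / 2"

lemma init_prob_eq: "init_prob N V1 \<eta> \<sigma> = (\<Prod>u\<in>{0..<N}. init_weight V1 \<eta> u (\<sigma> u))"
  unfolding init_prob_def init_weight_def label_def atLeast0LessThan ..

text \<open>Independence of the initial spins: a sum over the function space of a product over nodes
  is a product of two-point sums.\<close>

lemma init_prob_expectation_prod: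
  "(\<Sum>\<sigma>\<in>configs N. init_prob N V1 \<eta> \<sigma> * (\<Prod>u\<in>{0..<N}. f u (\<sigma> u)))
   = (\<Prod>u\<in>{0..<N}. \<Sum>y\<in>{-1, 1}. init_weight V1 \<eta> u y * f u y)"
  unfolding configs_def by (subst prod_sum_PiE) (auto simp: init_prob_eq prod.distrib)

lemma init_weight_sum: "(\<Sum>y\<in>{-1, 1}. init_weight V1 \<eta> u y) = 1"
  by (simp add: init_weight_def label_def field_simps)

text \<open>The uniform part of the law has mean zero, so an initial spin has mean
  \<open>\<eta>\<close> times its label.\<close>

lemma init_weight_centred: "(\<Sum>y\<in>{-1, 1}. init_weight V1 \<eta> u y * (y - \<eta> * label V1 u)) = 0"
  by (simp add: init_weight_def label_def field_simps)

lemma init_prob_nonneg: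
  assumes "0 \<le> \<eta>" "\<eta> \<le> 1"
  shows "init_prob N V1 \<eta> \<sigma> \<ge> 0"
  unfolding init_prob_def using assms by (intro prod_nonneg) auto

lemma init_prob_sum: "(\<Sum>\<sigma>\<in>configs N. init_prob N V1 \<eta> \<sigma>) = 1"
  using init_prob_expectation_prod[of N V1 \<eta> "\<lambda>_ _. 1"]
  by (simp only: init_weight_sum mult_1_right prod.neutral_const)

text \<open>The product formula is applied with factors equal to 1 away from \<open>u\<close> and
  \<open>v\<close>; the factor at \<open>u\<close> then has mean zero.\<close>

lemma init_prob_uncorrelated:
  assumes "u < N" "v < N" "u \<noteq> v"
  shows "(\<Sum>\<sigma>\<in>configs N. init_prob N V1 \<eta> \<sigma> *
            ((\<sigma> u - \<eta> * label V1 u) * (\<sigma> v - \<eta> * label V1 v))) = 0"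
proof -
  define f where "f w y = (if w = u \<or> w = v then y - \<eta> * label V1 w else 1)" for w y
  have "(\<Prod>w\<in>{0..<N}. f w (\<sigma> w)) = (\<Prod>w\<in>{u, v}. f w (\<sigma> w))" for \<sigma>
    using assms by (intro prod.mono_neutral_right) (auto simp: f_def)
  then have "(\<Prod>w\<in>{0..<N}. f w (\<sigma> w)) = (\<sigma> u - \<eta> * label V1 u) * (\<sigma> v - \<eta> * label V1 v)" for \<sigma>
    using assms by (simp add: f_def)
  moreover have "(\<Prod>w\<in>{0..<N}. \<Sum>y\<in>{-1, 1}. init_weight V1 \<eta> w y * f w y) = 0"
  proof (rule prod_zero)
    show "\<exists>w\<in>{0..<N}. (\<Sum>y\<in>{-1, 1}. init_weight V1 \<eta> w y * f w y) = 0"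
      using assms init_weight_centred[of V1 \<eta> u] by (intro bexI[of _ u]) (auto simp: f_def)
  qed simp
  ultimately show ?thesis using init_prob_expectation_prod[of N V1 \<eta> f] by simp
qed

text \<open>In the expanded square the mixed terms vanish, and a diagonal term is at most 4 because
  a spin deviates from its mean by at most 2.\<close>

lemma init_prob_variance_le:
  assumes \<eta>: "0 \<le> \<eta>" "\<eta> \<le> 1" and A: "A \<subseteq> {..<N}"
  shows "(\<Sum>\<sigma>\<in>configs N. init_prob N V1 \<eta> \<sigma> * (\<Sum>u\<in>A. \<sigma> u - \<eta> * label V1 u)\<^sup>2) \<le> 4 * card A"
proof -
  let ?d = "\<lambda>\<sigma> u. \<sigma> u - \<eta> * label V1 u" and ?P = "init_prob N V1 \<eta>"
  have fin: "finite A" using A finite_subset by blast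
  have "(\<Sum>\<sigma>\<in>configs N. ?P \<sigma> * (\<Sum>u\<in>A. ?d \<sigma> u)\<^sup>2)
      = (\<Sum>\<sigma>\<in>configs N. \<Sum>u\<in>A. \<Sum>v\<in>A. ?P \<sigma> * (?d \<sigma> u * ?d \<sigma> v))"
    unfolding power2_eq_square sum_product unfolding sum_distrib_left ..
  also have "\<dots> = (\<Sum>u\<in>A. \<Sum>v\<in>A. \<Sum>\<sigma>\<in>configs N. ?P \<sigma> * (?d \<sigma> u * ?d \<sigma> v))"
    by (subst sum.swap, intro sum.cong refl, rule sum.swap)
  also have "\<dots> \<le> (\<Sum>u\<in>A. \<Sum>v\<in>A. if v = u then 4 else 0)"
  proof (intro sum_mono)
    fix u v assume uv: "u \<in> A" "v \<in> A"
    have "(\<Sum>\<sigma>\<in>configs N. ?P \<sigma> * (?d \<sigma> u * ?d \<sigma> u)) \<le> (\<Sum>\<sigma>\<in>configs N. ?P \<sigma> * 4)"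
    proof (intro sum_mono mult_left_mono init_prob_nonneg \<eta>)
      fix \<sigma> assume "\<sigma> \<in> configs N"
      then have "\<bar>?d \<sigma> u\<bar> \<le> 2"
        using configs_values[of \<sigma> N u] subsetD[OF A uv(1)] \<eta> by (auto simp: label_def)
      then have "\<bar>?d \<sigma> u\<bar>\<^sup>2 \<le> 2\<^sup>2" by (intro power_mono) auto
      then show "?d \<sigma> u * ?d \<sigma> u \<le> 4" by (simp add: power2_eq_square)
    qed
    also have "\<dots> = 4" by (simp add: init_prob_sum flip: sum_distrib_right)
    finally show "(\<Sum>\<sigma>\<in>configs N. ?P \<sigma> * (?d \<sigma> u * ?d \<sigma> v)) \<le> (if v = u then 4 else 0)"
      using init_prob_uncorrelated[of u N v V1 \<eta>] subsetD[OF A uv(1)] subsetD[OF A uv(2)] by auto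
  qed
  also have "\<dots> = 4 * card A" using fin by simp
  finally show ?thesis .
qed

text \<open>The squared distance \<open>D\<close> of the outline. The parameter \<open>m\<close>
  stays free because the target point moves with time.\<close>

definition ray_dist2 :: "nat \<Rightarrow> nat \<Rightarrow> real \<Rightarrow> (nat \<Rightarrow> real) \<Rightarrow> real" where
  "ray_dist2 V1 V2 m \<sigma> = (magnet {0..<V1} \<sigma> - m)\<^sup>2 + (magnet {V1..<V1 + V2} \<sigma> + m)\<^sup>2"

text \<open>At time 0 the target is the mean of the two magnetisations, so the left side is a sum of
  two variances of averages.\<close>

lemma init_prob_ray_dist2_le:
  assumes \<eta>: "0 \<le> \<eta>" "\<eta> \<le> 1" and V: "V1 > 0" "V2 > 0"
  shows "(\<Sum>\<sigma>\<in>configs (V1 + V2). init_prob (V1 + V2) V1 \<eta> \<sigma> * ray_dist2 V1 V2 \<eta> \<sigma>) \<le> 4 / V1 + 4 / V2"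
proof -
  let ?P = "init_prob (V1 + V2) V1 \<eta>"
  let ?S = "\<lambda>A. \<Sum>\<sigma>\<in>configs (V1 + V2). ?P \<sigma> * (\<Sum>u\<in>A. \<sigma> u - \<eta> * label V1 u)\<^sup>2"
  have "magnet {0..<V1} \<sigma> - \<eta> = (\<Sum>u\<in>{0..<V1}. \<sigma> u - \<eta> * label V1 u) / V1" for \<sigma>
    using V by (simp add: magnet_def label_def sum_subtractf field_simps)
  moreover have "magnet {V1..<V1 + V2} \<sigma> + \<eta> = (\<Sum>u\<in>{V1..<V1 + V2}. \<sigma> u - \<eta> * label V1 u) / V2" for \<sigma>
    using V by (simp add: magnet_def label_def sum.distrib field_simps)
  ultimately have "(\<Sum>\<sigma>\<in>configs (V1 + V2). ?P \<sigma> * ray_dist2 V1 V2 \<eta> \<sigma>)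
      = ?S {0..<V1} / V1\<^sup>2 + ?S {V1..<V1 + V2} / V2\<^sup>2"
    by (simp only: ray_dist2_def power_divide distrib_left sum.distrib
        sum_divide_distrib[of _ "configs (V1 + V2)"] times_divide_eq_right of_nat_power)
  also have "\<dots> \<le> 4 * card {0..<V1} / V1\<^sup>2 + 4 * card {V1..<V1 + V2} / V2\<^sup>2"
    by (intro add_mono divide_right_mono init_prob_variance_le \<eta>) auto
  also have "\<dots> = 4 / V1 + 4 / V2" using V by (simp add: power2_eq_square)
  finally show ?thesis .
qed

section \<open>Drift of the magnetisations\<close>

lemma magnet_flip:
  assumes "finite A"
  shows "magnet A (flip \<sigma> u) = (if u \<in> A then magnet A \<sigma> - 2 * \<sigma> u / card A else magnet A \<sigma>)"
proof (cases "u \<in> A")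
  case True
  have "(\<Sum>v\<in>A. flip \<sigma> u v) = flip \<sigma> u u + (\<Sum>v\<in>A - {u}. flip \<sigma> u v)"
    using assms True by (rule sum.remove)
  also have "(\<Sum>v\<in>A - {u}. flip \<sigma> u v) = (\<Sum>v\<in>A - {u}. \<sigma> v)"
    by (intro sum.cong) (auto simp: flip_def)
  also have "\<dots> = (\<Sum>v\<in>A. \<sigma> v) - \<sigma> u"
    using assms True by (simp add: sum_diff1)
  finally show ?thesis
    using True by (simp add: magnet_def flip_def diff_divide_distrib)
next
  case False
  then have "(\<Sum>v\<in>A. flip \<sigma> u v) = (\<Sum>v\<in>A. \<sigma> v)"
    by (intro sum.cong) (auto simp: flip_def)
  then show ?thesis using False by (simp add: magnet_def)
qed

text \<open>The ideal rate \<open>(1 - s * \<sigma> u) / 2\<close> flips exactly the spins that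
  differ from \<open>s\<close>, at rate 1, and gives the magnetisation the drift
  \<open>s - magnet A \<sigma>\<close>. The target \<open>s * m\<close> moves at speed
  \<open>s * (1 - m)\<close>, so the deviation \<open>X\<close> has drift \<open>- X + d\<close>,
  where \<open>d\<close> collects the rate errors. The term \<open>4 / V\<close> bounds the
  contribution of squared jumps.\<close>

lemma community_drift_le:
  fixes r \<sigma> :: "nat \<Rightarrow> real" and m :: real
  assumes A: "finite A" "A \<noteq> {}" and \<sigma>: "\<And>u. u \<in> A \<Longrightarrow> \<sigma> u = 1 \<or> \<sigma> u = -1"
    and r: "\<And>u. u \<in> A \<Longrightarrow> r u \<le> 1"
    and s: "s = 1 \<or> s = -1"
  defines "V \<equiv> real (card A)" and "X \<equiv> magnet A \<sigma> - s * m"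
  shows "(\<Sum>u\<in>A. r u * (2 * X * (- 2 * \<sigma> u / V) + 4 / V\<^sup>2)) - 2 * X * s * (1 - m)
    \<le> (2 / V * (\<Sum>u\<in>A. \<bar>r u - (1 - s * \<sigma> u) / 2\<bar>))\<^sup>2 + 4 / V"
proof -
  have V: "V > 0" using A by (simp add: V_def card_gt_0_iff)
  have abs_\<sigma>: "\<bar>\<sigma> u\<bar> = 1" if "u \<in> A" for u using \<sigma>[OF that] by auto
  define d where "d = (\<Sum>u\<in>A. (r u - (1 - s * \<sigma> u) / 2) * (- 2 * \<sigma> u)) / V"
  have "\<bar>d\<bar> \<le> (\<Sum>u\<in>A. \<bar>r u - (1 - s * \<sigma> u) / 2\<bar> * 2) / V"
    unfolding d_def abs_divide using V abs_\<sigma>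
    by (auto intro!: divide_right_mono order_trans[OF sum_abs] sum_mono simp: abs_mult)
  also have "\<dots> = 2 / V * (\<Sum>u\<in>A. \<bar>r u - (1 - s * \<sigma> u) / 2\<bar>)"
    by (simp add: sum_distrib_right[symmetric])
  finally have d: "d\<^sup>2 \<le> (2 / V * (\<Sum>u\<in>A. \<bar>r u - (1 - s * \<sigma> u) / 2\<bar>))\<^sup>2"
    using power_mono[of "\<bar>d\<bar>" _ 2] by simp
  have "(\<Sum>u\<in>A. r u * (- 2 * \<sigma> u)) = (\<Sum>u\<in>A. s - \<sigma> u) + (\<Sum>u\<in>A. (r u - (1 - s * \<sigma> u) / 2) * (- 2 * \<sigma> u))"
    unfolding sum.distrib[symmetric]
  proof (intro sum.cong refl)
    fix u assume "u \<in> A"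
    from \<sigma>[OF this] show "r u * (- 2 * \<sigma> u) = s - \<sigma> u + (r u - (1 - s * \<sigma> u) / 2) * (- 2 * \<sigma> u)"
      by (auto simp: field_simps)
  qed
  also have "(\<Sum>u\<in>A. s - \<sigma> u) = V * (s - magnet A \<sigma>)"
    using V by (simp add: magnet_def V_def sum_subtractf right_diff_distrib)
  also have "(\<Sum>u\<in>A. (r u - (1 - s * \<sigma> u) / 2) * (- 2 * \<sigma> u)) = V * d"
    using V by (simp add: d_def)
  finally have "(\<Sum>u\<in>A. r u * (- 2 * \<sigma> u)) = V * (s - magnet A \<sigma> + d)"
    by (simp only: distrib_left)
  then have dr: "(\<Sum>u\<in>A. r u * (- 2 * \<sigma> u)) / V = s - magnet A \<sigma> + d" using V by simp
  have "(\<Sum>u\<in>A. r u * (2 * X * (- 2 * \<sigma> u / V) + 4 / V\<^sup>2))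
      = 2 * X * (s - magnet A \<sigma> + d) + (\<Sum>u\<in>A. r u) * (4 / V\<^sup>2)"
    unfolding dr[symmetric] sum_divide_distrib sum_distrib_left sum_distrib_right sum.distrib[symmetric]
    by (intro sum.cong) (auto simp: algebra_simps)
  moreover have "(\<Sum>u\<in>A. r u) * (4 / V\<^sup>2) \<le> 4 / V"
  proof -
    have "(\<Sum>u\<in>A. r u) \<le> V" using sum_mono[of A r "\<lambda>_. 1"] r by (simp add: V_def)
    then have "(\<Sum>u\<in>A. r u) * (4 / V\<^sup>2) \<le> V * (4 / V\<^sup>2)" by (intro mult_right_mono) auto
    then show ?thesis using V by (simp add: power2_eq_square)
  qed
  moreover have "2 * X * (s - magnet A \<sigma> + d) - 2 * X * s * (1 - m) \<le> d\<^sup>2"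
  proof -
    \<comment> \<open>The left side is \<open>2 * X * (d - X)\<close>; completing the square
      isolates \<open>d\<close> squared.\<close>
    have "2 * X * (s - magnet A \<sigma> + d) - 2 * X * s * (1 - m) = d\<^sup>2 - X\<^sup>2 - (X - d)\<^sup>2"
      unfolding X_def by (simp add: power2_eq_square algebra_simps)
    then show ?thesis by simp
  qed
  ultimately show ?thesis using d by linarith
qed

text \<open>Distance of a flip rate from the ideal one, which is 1 for a spin that disagrees with
  its label and 0 otherwise.\<close>

definition rate_error :: "nat \<Rightarrow> (nat \<Rightarrow> real) \<Rightarrow> (nat \<Rightarrow> real) \<Rightarrow> nat \<Rightarrow> real" where
  "rate_error V1 \<sigma> r u = \<bar>r u - (1 - label V1 u * \<sigma> u) / 2\<bar>"

text \<open>Sum of the community estimates with signs 1 and -1. The term with factor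
  \<open>1 - m\<close> is the time derivative of the squared distance when \<open>m\<close> solves
  \<open>m' = 1 - m\<close>.\<close>

lemma ray_dist2_drift_le:
  assumes \<sigma>: "\<sigma> \<in> configs (V1 + V2)" and V: "V1 > 0" "V2 > 0"
    and r: "\<And>u. u < V1 + V2 \<Longrightarrow> r u \<le> 1"
  shows "(\<Sum>u<V1 + V2. r u * (ray_dist2 V1 V2 m (flip \<sigma> u) - ray_dist2 V1 V2 m \<sigma>))
      + (2 * (magnet {V1..<V1 + V2} \<sigma> + m) - 2 * (magnet {0..<V1} \<sigma> - m)) * (1 - m)
    \<le> (2 / V1 * (\<Sum>u\<in>{0..<V1}. rate_error V1 \<sigma> r u))\<^sup>2
      + (2 / V2 * (\<Sum>u\<in>{V1..<V1 + V2}. rate_error V1 \<sigma> r u))\<^sup>2 + 4 / V1 + 4 / V2"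
proof -
  let ?A = "{0..<V1}" and ?B = "{V1..<V1 + V2}"
  let ?X = "magnet ?A \<sigma> - 1 * m" and ?Y = "magnet ?B \<sigma> - (- 1) * m"
  have sq: "\<sigma> u * \<sigma> u = 1" if "u < V1 + V2" for u
    using configs_values[OF \<sigma> that] by auto
  have 1: "ray_dist2 V1 V2 m (flip \<sigma> u) - ray_dist2 V1 V2 m \<sigma>
      = 2 * ?X * (- 2 * \<sigma> u / V1) + 4 / V1\<^sup>2" if u: "u \<in> ?A" for u
  proof -
    have "ray_dist2 V1 V2 m (flip \<sigma> u) - ray_dist2 V1 V2 m \<sigma>
       = 2 * ?X * (- 2 * \<sigma> u / V1) + 4 * (\<sigma> u * \<sigma> u) / V1\<^sup>2"
      using u V by (simp add: ray_dist2_def magnet_flip power2_eq_square field_simps)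
    then show ?thesis using u by (simp add: sq)
  qed
  have 2: "ray_dist2 V1 V2 m (flip \<sigma> u) - ray_dist2 V1 V2 m \<sigma>
      = 2 * ?Y * (- 2 * \<sigma> u / V2) + 4 / V2\<^sup>2" if u: "u \<in> ?B" for u
  proof -
    have "ray_dist2 V1 V2 m (flip \<sigma> u) - ray_dist2 V1 V2 m \<sigma>
       = 2 * ?Y * (- 2 * \<sigma> u / V2) + 4 * (\<sigma> u * \<sigma> u) / V2\<^sup>2"
      using u V by (simp add: ray_dist2_def magnet_flip power2_eq_square field_simps)
    then show ?thesis using u by (simp add: sq)
  qed
  have "(\<Sum>u<V1 + V2. r u * (ray_dist2 V1 V2 m (flip \<sigma> u) - ray_dist2 V1 V2 m \<sigma>))
      = (\<Sum>u\<in>?A. r u * (2 * ?X * (- 2 * \<sigma> u / V1) + 4 / V1\<^sup>2))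
      + (\<Sum>u\<in>?B. r u * (2 * ?Y * (- 2 * \<sigma> u / V2) + 4 / V2\<^sup>2))"
    unfolding lessThan_atLeast0 sum.atLeastLessThan_concat[of 0 V1 "V1 + V2", simplified, symmetric]
    by (intro arg_cong2[where f = "(+)"] sum.cong refl) (simp_all only: 1 2)
  moreover have "(\<Sum>u\<in>?A. r u * (2 * ?X * (- 2 * \<sigma> u / V1) + 4 / V1\<^sup>2)) - 2 * ?X * 1 * (1 - m)
      \<le> (2 / V1 * (\<Sum>u\<in>?A. rate_error V1 \<sigma> r u))\<^sup>2 + 4 / V1"
    using community_drift_le[of ?A \<sigma> r 1 m] V r configs_values[OF \<sigma>]
    by (simp add: rate_error_def label_def)
  moreover have "(\<Sum>u\<in>?B. r u * (2 * ?Y * (- 2 * \<sigma> u / V2) + 4 / V2\<^sup>2)) - 2 * ?Y * (- 1) * (1 - m)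
      \<le> (2 / V2 * (\<Sum>u\<in>?B. rate_error V1 \<sigma> r u))\<^sup>2 + 4 / V2"
    using community_drift_le[of ?B \<sigma> r "-1" m] V r configs_values[OF \<sigma>]
    by (simp add: rate_error_def label_def)
  ultimately show ?thesis by (simp add: algebra_simps)
qed

text \<open>A concave function lies below its tangent at \<open>x\<close>. This passes drift bounds
  from the squared distance to its concave transform.\<close>

lemma one_minus_exp_increment_le:
  fixes k x y :: real
  shows "(1 - exp (- k * y)) - (1 - exp (- k * x)) \<le> k * exp (- k * x) * (y - x)"
proof -
  have "exp (- k * x) * (1 + - k * (y - x)) \<le> exp (- k * x) * exp (- k * (y - x))"
    by (intro mult_left_mono exp_ge_add_one_self) auto
  also have "\<dots> = exp (- k * y)" by (simp add: exp_add[symmetric] algebra_simps)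
  finally show ?thesis by (simp add: algebra_simps)
qed

section \<open>The local field as noise plus mean, and the resulting flip rates\<close>

text \<open>The local field with every edge indicator replaced by its probability. Subtracting
  \<open>\<sigma> u\<close> removes the interaction of a node with itself, which the community total
  contains.\<close>

definition mean_field :: "nat \<Rightarrow> nat \<Rightarrow> real \<Rightarrow> real \<Rightarrow> real \<Rightarrow> (nat \<Rightarrow> real) \<Rightarrow> nat \<Rightarrow> real" where
  "mean_field V1 V2 pin pout alph \<sigma> u =
     (if u < V1
      then (pin - alph) * (V1 * magnet {0..<V1} \<sigma> - \<sigma> u) + (pout - alph) * (V2 * magnet {V1..<V1 + V2} \<sigma>)
      else (pout - alph) * (V1 * magnet {0..<V1} \<sigma>) + (pin - alph) * (V2 * magnet {V1..<V1 + V2} \<sigma> - \<sigma> u))"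

lemma Delta_eq_noise_plus_mean_field:
  assumes u: "u < V1 + V2" and V: "V1 > 0" "V2 > 0"
  shows "Delta (V1 + V2) E alph \<sigma> u =
    2 * \<sigma> u * (noise (V1 + V2) V1 pin pout E \<sigma> u + mean_field V1 V2 pin pout alph \<sigma> u)"
proof -
  let ?N = "V1 + V2" and ?q = "\<lambda>v. edge_prob V1 pin pout (u, v)"
  have adj_sum: "(\<Sum>v\<in>{v. v < ?N \<and> adj E u v}. \<sigma> v) = (\<Sum>v\<in>{0..<?N} - {u}. if adj E u v then \<sigma> v else 0)"
    unfolding sum.inter_filter[symmetric, OF finite_Diff[OF finite_atLeastLessThan]]
    by (intro sum.cong) (auto simp: adj_def)
  have 1: "(\<Sum>v\<in>{v. v < ?N \<and> adj E u v}. \<sigma> v) - alph * (\<Sum>v\<in>{0..<?N} - {u}. \<sigma> v)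
      = noise ?N V1 pin pout E \<sigma> u + (\<Sum>v\<in>{0..<?N} - {u}. (?q v - alph) * \<sigma> v)"
    unfolding adj_sum noise_def sum_distrib_left sum.distrib[symmetric] sum_subtractf[symmetric]
    by (intro sum.cong refl) (simp add: algebra_simps)
  have "(\<Sum>v\<in>{0..<?N} - {u}. (?q v - alph) * \<sigma> v)
      = (\<Sum>v\<in>{0..<?N}. (?q v - alph) * \<sigma> v) - (?q u - alph) * \<sigma> u"
    using u by (simp add: sum_diff1)
  also have "(\<Sum>v\<in>{0..<?N}. (?q v - alph) * \<sigma> v)
      = (\<Sum>v\<in>{0..<V1}. (?q v - alph) * \<sigma> v) + (\<Sum>v\<in>{V1..<?N}. (?q v - alph) * \<sigma> v)"
    by (rule sum.atLeastLessThan_concat[symmetric]) auto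
  also have "(\<Sum>v\<in>{0..<V1}. (?q v - alph) * \<sigma> v)
      = ((if u < V1 then pin else pout) - alph) * (\<Sum>v\<in>{0..<V1}. \<sigma> v)"
    unfolding sum_distrib_left by (intro sum.cong) (auto simp: edge_prob_def)
  also have "(\<Sum>v\<in>{V1..<?N}. (?q v - alph) * \<sigma> v)
      = ((if u < V1 then pout else pin) - alph) * (\<Sum>v\<in>{V1..<?N}. \<sigma> v)"
    unfolding sum_distrib_left by (intro sum.cong) (auto simp: edge_prob_def)
  also have "((if u < V1 then pin else pout) - alph) * (\<Sum>v\<in>{0..<V1}. \<sigma> v)
      + ((if u < V1 then pout else pin) - alph) * (\<Sum>v\<in>{V1..<?N}. \<sigma> v) - (?q u - alph) * \<sigma> u
      = mean_field V1 V2 pin pout alph \<sigma> u"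
    using V by (simp add: mean_field_def magnet_def edge_prob_def algebra_simps)
  finally show ?thesis unfolding Delta_def 1 by simp
qed

text \<open>If the noise \<open>w\<close> reaches \<open>\<gamma>\<close>, the trivial bound 1 is at
  most \<open>\<bar>w\<bar> / \<gamma>\<close>. Otherwise \<open>w + h\<close> keeps the sign
  \<open>s\<close> with margin \<open>\<gamma>\<close>, and the tail of the logistic function gives
  \<open>\<epsilon>\<close>. The bound is linear in the noise, so that summing over nodes involves
  only its \<open>\<ell>\<^sub>1\<close> norm.\<close>

lemma flip_rate_error_le:
  fixes w h s x \<gamma> \<epsilon> :: real
  assumes \<gamma>: "\<gamma> > 0" and \<epsilon>: "\<epsilon> \<ge> 0" and \<beta>: "\<beta> > 0" "\<beta> = \<infinity> \<or> exp (- 2 * real_of_ereal \<beta> * \<gamma>) \<le> \<epsilon>"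
    and s: "s = 1 \<or> s = -1" and x: "x = 1 \<or> x = -1" and h: "s * h \<ge> 2 * \<gamma>"
  shows "\<bar>flip_rate \<beta> (2 * x * (w + h)) - (1 - s * x) / 2\<bar> \<le> \<epsilon> + \<bar>w\<bar> / \<gamma>"
proof (cases "\<bar>w\<bar> \<ge> \<gamma>")
  case True
  then have "1 \<le> \<bar>w\<bar> / \<gamma>" using \<gamma> by simp
  then show ?thesis
    using flip_rate_bounds[of \<beta> "2 * x * (w + h)"] s x \<epsilon> by auto
next
  case False
  define y where "y = 2 * x * (w + h)"
  define b where "b = real_of_ereal \<beta>"
  have *: "1 / (1 + exp z) \<le> exp (- z)" for z :: real
    by (simp add: exp_minus field_simps add_pos_pos)
  have b: "b \<ge> 0" using \<beta>(1) unfolding b_def by (simp add: real_of_ereal_pos)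
  have "\<bar>flip_rate \<beta> y - (1 - s * x) / 2\<bar> \<le> \<epsilon>"
  proof (cases "x = s")
    case True
    then have y: "y \<ge> 2 * \<gamma>" using False h s by (auto simp: y_def)
    have x: "(1 - s * x) / 2 = 0" using True s by auto
    have "1 / (1 + exp (b * y)) \<le> exp (- (b * y))" by (rule *)
    also have "\<dots> \<le> exp (- 2 * b * \<gamma>)" using mult_left_mono[OF y b] by simp
    finally show ?thesis unfolding x using \<beta> \<epsilon> y \<gamma> flip_rate_bounds(1)[of \<beta> y]
      by (auto simp: flip_rate_def b_def[symmetric])
  next
    case False': False
    then have xs: "x = - s" using s x by auto
    then have y: "y \<le> - 2 * \<gamma>" using False h s by (auto simp: y_def)
    have x: "(1 - s * x) / 2 = 1" using xs s by auto
    have "1 + exp (b * y) > 0" by (simp add: add_pos_pos)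
    then have "1 - 1 / (1 + exp (b * y)) = 1 / (1 + exp (- (b * y)))"
      by (simp add: exp_minus divide_simps)
    also have "\<dots> \<le> exp (b * y)" using *[of "- (b * y)"] by simp
    also have "\<dots> \<le> exp (- 2 * b * \<gamma>)" using mult_left_mono[OF y b] by simp
    finally show ?thesis unfolding x using \<beta> \<epsilon> y \<gamma> flip_rate_bounds(2)[of \<beta> y]
      by (auto simp: flip_rate_def b_def[symmetric])
  qed
  then show ?thesis using \<gamma> by (simp add: y_def add_increasing2)
qed

section \<open>The Lyapunov function\<close>

text \<open>The a priori bound for configurations far from the target, where nothing is known about
  the fields.\<close>

lemma sum_mean_rate_error_le:
  assumes "finite A" "\<And>u. u \<in> A \<Longrightarrow> 0 \<le> r u \<and> r u \<le> 1" "\<And>u. u \<in> A \<Longrightarrow> \<sigma> u = 1 \<or> \<sigma> u = -1"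
  shows "2 / real (card A) * (\<Sum>u\<in>A. rate_error V1 \<sigma> r u) \<le> 2"
proof -
  have "(\<Sum>u\<in>A. rate_error V1 \<sigma> r u) \<le> (\<Sum>u\<in>A. 1)"
  proof (rule sum_mono)
    fix u assume "u \<in> A"
    then show "rate_error V1 \<sigma> r u \<le> 1"
      using assms(2)[of u] assms(3)[of u] label_cases[of V1 u] by (auto simp: rate_error_def)
  qed
  then show ?thesis by (cases "card A = 0") (auto simp: field_simps)
qed

text \<open>The first summand serves configurations within \<open>\<rho>\<close> of the target, with
  total rate error \<open>\<delta>\<close>. The second serves all others: there 16 is
  \<open>2\<^sup>2 + 2\<^sup>2 + 4 + 4\<close>, damped by the slope of the concave
  transform.\<close>

definition drift_bound :: "nat \<Rightarrow> nat \<Rightarrow> real \<Rightarrow> real \<Rightarrow> real \<Rightarrow> real" where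
  "drift_bound V1 V2 k \<rho> \<delta> =
     k * ((2 / V1 * \<delta>)\<^sup>2 + (2 / V2 * \<delta>)\<^sup>2 + 4 / V1 + 4 / V2) + 16 * k * exp (- k * \<rho>\<^sup>2)"

lemma drift_bound_nonneg: "k \<ge> 0 \<Longrightarrow> drift_bound V1 V2 k \<rho> \<delta> \<ge> 0"
  unfolding drift_bound_def by (intro add_nonneg_nonneg mult_nonneg_nonneg) auto

text \<open>By the tangent bound the total drift is at most \<open>k * exp (- k * D)\<close> times
  that of the squared distance \<open>D\<close>. Near the target the exponential is bounded by 1 and
  the drift of \<open>D\<close> is small; far from it the roles are exchanged.\<close>

lemma lyapunov_drift_le:
  assumes \<sigma>: "\<sigma> \<in> configs (V1 + V2)" and V: "V1 > 0" "V2 > 0" and k: "k \<ge> 0"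
    and r: "\<And>u. u < V1 + V2 \<Longrightarrow> 0 \<le> r u \<and> r u \<le> 1"
    and near: "ray_dist2 V1 V2 m \<sigma> \<le> \<rho>\<^sup>2 \<Longrightarrow> (\<Sum>u<V1 + V2. rate_error V1 \<sigma> r u) \<le> \<delta>"
  shows "k * exp (- k * ray_dist2 V1 V2 m \<sigma>) *
      ((2 * (magnet {V1..<V1 + V2} \<sigma> + m) - 2 * (magnet {0..<V1} \<sigma> - m)) * (1 - m))
      + (\<Sum>u<V1 + V2. r u * ((1 - exp (- k * ray_dist2 V1 V2 m (flip \<sigma> u)))
                            - (1 - exp (- k * ray_dist2 V1 V2 m \<sigma>)))) \<le> drift_bound V1 V2 k \<rho> \<delta>"
proof -
  let ?D = "ray_dist2 V1 V2 m"
  let ?t = "(2 * (magnet {V1..<V1 + V2} \<sigma> + m) - 2 * (magnet {0..<V1} \<sigma> - m)) * (1 - m)"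
  let ?S = "\<Sum>u<V1 + V2. r u * (?D (flip \<sigma> u) - ?D \<sigma>)"
  let ?e1 = "2 / V1 * (\<Sum>u\<in>{0..<V1}. rate_error V1 \<sigma> r u)"
  let ?e2 = "2 / V2 * (\<Sum>u\<in>{V1..<V1 + V2}. rate_error V1 \<sigma> r u)"
  define G where "G = ?e1\<^sup>2 + ?e2\<^sup>2 + 4 / V1 + 4 / V2"
  have err0: "rate_error V1 \<sigma> r u \<ge> 0" for u by (simp add: rate_error_def)
  have G0: "G \<ge> 0" unfolding G_def by simp
  have "(\<Sum>u<V1 + V2. r u * ((1 - exp (- k * ?D (flip \<sigma> u))) - (1 - exp (- k * ?D \<sigma>))))
      \<le> (\<Sum>u<V1 + V2. r u * (k * exp (- k * ?D \<sigma>) * (?D (flip \<sigma> u) - ?D \<sigma>)))"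
    by (intro sum_mono mult_left_mono one_minus_exp_increment_le) (simp add: r)
  also have "\<dots> = k * exp (- k * ?D \<sigma>) * ?S"
    by (simp add: sum_distrib_left mult_ac)
  finally have "k * exp (- k * ?D \<sigma>) * ?t
      + (\<Sum>u<V1 + V2. r u * ((1 - exp (- k * ?D (flip \<sigma> u))) - (1 - exp (- k * ?D \<sigma>))))
      \<le> k * exp (- k * ?D \<sigma>) * (?S + ?t)"
    by (simp add: distrib_left)
  also have "\<dots> \<le> k * exp (- k * ?D \<sigma>) * G"
    unfolding G_def using r k by (intro mult_left_mono ray_dist2_drift_le \<sigma> V) auto
  also have "\<dots> \<le> drift_bound V1 V2 k \<rho> \<delta>"
  proof (cases "?D \<sigma> \<le> \<rho>\<^sup>2")
    case True
    have "(\<Sum>u\<in>{0..<V1}. rate_error V1 \<sigma> r u) \<le> (\<Sum>u<V1 + V2. rate_error V1 \<sigma> r u)"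
      using err0 by (intro sum_mono2) auto
    then have "?e1\<^sup>2 \<le> (2 / V1 * \<delta>)\<^sup>2"
      using near[OF True] err0 by (intro power_mono mult_left_mono mult_nonneg_nonneg sum_nonneg) auto
    moreover have "(\<Sum>u\<in>{V1..<V1 + V2}. rate_error V1 \<sigma> r u) \<le> (\<Sum>u<V1 + V2. rate_error V1 \<sigma> r u)"
      using err0 by (intro sum_mono2) auto
    then have "?e2\<^sup>2 \<le> (2 / V2 * \<delta>)\<^sup>2"
      using near[OF True] err0 by (intro power_mono mult_left_mono mult_nonneg_nonneg sum_nonneg) auto
    ultimately have "G \<le> (2 / V1 * \<delta>)\<^sup>2 + (2 / V2 * \<delta>)\<^sup>2 + 4 / V1 + 4 / V2"
      unfolding G_def by linarith
    moreover have "exp (- k * ?D \<sigma>) \<le> 1" using k by (simp add: ray_dist2_def)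
    ultimately have "k * exp (- k * ?D \<sigma>) * G
        \<le> k * 1 * ((2 / V1 * \<delta>)\<^sup>2 + (2 / V2 * \<delta>)\<^sup>2 + 4 / V1 + 4 / V2)"
      using k G0 by (intro mult_mono mult_left_mono) auto
    also have "\<dots> \<le> drift_bound V1 V2 k \<rho> \<delta>" using k by (simp add: drift_bound_def)
    finally show ?thesis .
  next
    case False
    have "?e1 \<le> 2" using sum_mean_rate_error_le[of "{0..<V1}" r \<sigma> V1] r configs_values[OF \<sigma>] by simp
    then have "?e1\<^sup>2 \<le> 2\<^sup>2" using err0 by (intro power_mono mult_nonneg_nonneg sum_nonneg) auto
    moreover have "?e2 \<le> 2"
      using sum_mean_rate_error_le[of "{V1..<V1 + V2}" r \<sigma> V1] r configs_values[OF \<sigma>] by simp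
    then have "?e2\<^sup>2 \<le> 2\<^sup>2" using err0 by (intro power_mono mult_nonneg_nonneg sum_nonneg) auto
    moreover have "4 / real V1 \<le> 4" "4 / real V2 \<le> 4" using V by (auto simp: field_simps)
    ultimately have "G \<le> 16" unfolding G_def by simp
    moreover have "exp (- k * ?D \<sigma>) \<le> exp (- k * \<rho>\<^sup>2)" using k False by (simp add: mult_left_mono)
    ultimately have "k * exp (- k * ?D \<sigma>) * G \<le> k * exp (- k * \<rho>\<^sup>2) * 16"
      using k G0 by (intro mult_mono mult_left_mono) auto
    also have "\<dots> \<le> drift_bound V1 V2 k \<rho> \<delta>" using k by (simp add: drift_bound_def)
    finally show ?thesis .
  qed
  finally show ?thesis .
qed

section \<open>The moving target and the expectation of the Lyapunov function\<close>

text \<open>The solution of \<open>m' = 1 - m\<close> with \<open>m 0 = \<eta>\<close>, which the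
  magnetisations follow up to sign under the ideal rates.\<close>

definition ray_time :: "real \<Rightarrow> real \<Rightarrow> real" where
  "ray_time \<eta> t = 1 - (1 - \<eta>) * exp (- t)"

lemma ray_time_bounds:
  assumes "0 \<le> \<eta>" "\<eta> \<le> 1" "t \<ge> 0"
  shows "\<eta> \<le> ray_time \<eta> t" "ray_time \<eta> t \<le> 1"
  using assms mult_left_mono[of "exp (- t)" 1 "1 - \<eta>"] by (auto simp: ray_time_def)

definition lyapunov :: "nat \<Rightarrow> nat \<Rightarrow> real \<Rightarrow> real \<Rightarrow> real \<Rightarrow> (nat \<Rightarrow> real) \<Rightarrow> real" where
  "lyapunov V1 V2 \<eta> k t \<sigma> = 1 - exp (- k * ray_dist2 V1 V2 (ray_time \<eta> t) \<sigma>)"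

lemma lyapunov_deriv:
  "((\<lambda>t. lyapunov V1 V2 \<eta> k t \<sigma>) has_real_derivative
     k * exp (- k * ray_dist2 V1 V2 (ray_time \<eta> t) \<sigma>) *
      ((2 * (magnet {V1..<V1 + V2} \<sigma> + ray_time \<eta> t) - 2 * (magnet {0..<V1} \<sigma> - ray_time \<eta> t)) *
       (1 - ray_time \<eta> t))) (at t)"
  unfolding lyapunov_def ray_dist2_def ray_time_def
  by (auto intro!: derivative_eq_intros simp: algebra_simps)

text \<open>The bound for one graph with small noise and one initial configuration. Summing
  \<open>flip_rate_error_le\<close> over the nodes gives the total rate error
  \<open>N * \<epsilon> + s / \<gamma>\<close>. The margin is asked for \<open>m\<close> between
  \<open>\<eta>\<close> and 1, the range of \<open>ray_time\<close>.\<close>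

lemma lyapunov_expectation_le:
  fixes V1 V2 :: nat
  defines "N \<equiv> V1 + V2"
  assumes V: "V1 > 0" "V2 > 0" and k: "k \<ge> 0" and \<eta>: "0 \<le> \<eta>" "\<eta> \<le> 1" and T: "T \<ge> 0"
    and \<gamma>: "\<gamma> > 0" and \<epsilon>: "\<epsilon> \<ge> 0" and \<beta>: "\<beta> > 0" "\<beta> = \<infinity> \<or> exp (- 2 * real_of_ereal \<beta> * \<gamma>) \<le> \<epsilon>"
    and noise: "\<And>\<sigma>. \<sigma> \<in> configs N \<Longrightarrow> (\<Sum>u<N. \<bar>noise N V1 pin pout E \<sigma> u\<bar>) \<le> s"
    and field: "\<And>m \<sigma> u. \<eta> \<le> m \<Longrightarrow> m \<le> 1 \<Longrightarrow> \<sigma> \<in> configs N \<Longrightarrow> u < N \<Longrightarrow>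
       ray_dist2 V1 V2 m \<sigma> \<le> \<rho>\<^sup>2 \<Longrightarrow> label V1 u * mean_field V1 V2 pin pout alph \<sigma> u \<ge> 2 * \<gamma>"
    and \<sigma>0: "\<sigma>0 \<in> configs N"
  shows "(\<Sum>\<sigma>\<in>configs N. ctmc_trans (configs N) (generator N E alph \<beta>) T \<sigma>0 \<sigma> * lyapunov V1 V2 \<eta> k T \<sigma>)
    \<le> k * ray_dist2 V1 V2 \<eta> \<sigma>0 + drift_bound V1 V2 k \<rho> (N * \<epsilon> + s / \<gamma>) * T"
proof -
  let ?Q = "generator N E alph \<beta>" and ?\<kappa> = "drift_bound V1 V2 k \<rho> (N * \<epsilon> + s / \<gamma>)"
  have "(\<Sum>\<sigma>\<in>configs N. ctmc_trans (configs N) ?Q T \<sigma>0 \<sigma> * lyapunov V1 V2 \<eta> k T \<sigma>)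
      \<le> lyapunov V1 V2 \<eta> k 0 \<sigma>0 + ?\<kappa> * T"
  proof (rule ctmc_drift_inequality[OF finite_configs _ _ \<sigma>0 T lyapunov_deriv])
    show "?Q \<sigma> \<sigma>' \<ge> 0" if "\<sigma> \<noteq> \<sigma>'" for \<sigma> \<sigma>' using generator_nonneg[OF that] .
    show "(\<Sum>\<sigma>'\<in>configs N. ?Q \<sigma> \<sigma>') = 0" if "\<sigma> \<in> configs N" for \<sigma> using generator_row_sum[OF that] .
    fix t \<sigma> assume t: "(0::real) \<le> t" and \<sigma>: "\<sigma> \<in> configs N"
    let ?r = "\<lambda>u. flip_rate \<beta> (Delta N E alph \<sigma> u)" and ?m = "ray_time \<eta> t"
    have near: "(\<Sum>u<N. rate_error V1 \<sigma> ?r u) \<le> N * \<epsilon> + s / \<gamma>" if D: "ray_dist2 V1 V2 ?m \<sigma> \<le> \<rho>\<^sup>2"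
    proof -
      have "rate_error V1 \<sigma> ?r u \<le> \<epsilon> + \<bar>noise N V1 pin pout E \<sigma> u\<bar> / \<gamma>" if u: "u < N" for u
        using flip_rate_error_le[OF \<gamma> \<epsilon> \<beta> label_cases configs_values[OF \<sigma> u]
            field[OF ray_time_bounds[OF \<eta> t] \<sigma> u D], where w = "noise N V1 pin pout E \<sigma> u"]
          Delta_eq_noise_plus_mean_field[of u V1 V2 E alph \<sigma> pin pout] u V
        unfolding rate_error_def
        by (simp add: N_def)
      then have "(\<Sum>u<N. rate_error V1 \<sigma> ?r u) \<le> (\<Sum>u<N. \<epsilon> + \<bar>noise N V1 pin pout E \<sigma> u\<bar> / \<gamma>)"
        by (intro sum_mono) auto
      also have "\<dots> = N * \<epsilon> + (\<Sum>u<N. \<bar>noise N V1 pin pout E \<sigma> u\<bar>) / \<gamma>"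
        by (simp add: sum.distrib sum_divide_distrib)
      also have "\<dots> \<le> N * \<epsilon> + s / \<gamma>"
        using noise[OF \<sigma>] \<gamma> by (intro add_left_mono divide_right_mono) auto
      finally show ?thesis .
    qed
    show "k * exp (- k * ray_dist2 V1 V2 ?m \<sigma>) *
        ((2 * (magnet {V1..<V1 + V2} \<sigma> + ?m) - 2 * (magnet {0..<V1} \<sigma> - ?m)) * (1 - ?m))
        + (\<Sum>\<sigma>'\<in>configs N. ?Q \<sigma> \<sigma>' * lyapunov V1 V2 \<eta> k t \<sigma>') \<le> ?\<kappa>"
      unfolding generator_apply[OF \<sigma>] lyapunov_def
      using lyapunov_drift_le[of \<sigma> V1 V2 k ?r ?m \<rho>] \<sigma> V k near flip_rate_bounds
      by (simp add: N_def)
  qed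
  also have "lyapunov V1 V2 \<eta> k 0 \<sigma>0 \<le> k * ray_dist2 V1 V2 \<eta> \<sigma>0"
    using exp_ge_add_one_self[of "- k * ray_dist2 V1 V2 \<eta> \<sigma>0"] by (simp add: lyapunov_def ray_time_def)
  finally show ?thesis by simp
qed

text \<open>Graphs with large noise cost at most their probability, as \<open>f\<close> is at most
  1. On the others the Lyapunov bound is averaged over the initial law. The factor 2 fits indicators
  of events on which the Lyapunov function is at least one half.\<close>

lemma expect_at_le:
  fixes V1 V2 :: nat
  defines "N \<equiv> V1 + V2"
  assumes V: "V1 > 0" "V2 > 0" and k: "k \<ge> 0" and \<eta>: "0 \<le> \<eta>" "\<eta> \<le> 1" and T: "T \<ge> 0"
    and \<gamma>: "\<gamma> > 0" and \<epsilon>: "\<epsilon> \<ge> 0" and \<beta>: "\<beta> > 0" "\<beta> = \<infinity> \<or> exp (- 2 * real_of_ereal \<beta> * \<gamma>) \<le> \<epsilon>"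
    and p: "0 \<le> pin" "pin \<le> q" "0 \<le> pout" "pout \<le> q" "q \<le> 1"
    and \<theta>: "0 \<le> \<theta>" "\<theta> \<le> 1/2"
    and field: "\<And>m \<sigma> u. \<eta> \<le> m \<Longrightarrow> m \<le> 1 \<Longrightarrow> \<sigma> \<in> configs N \<Longrightarrow> u < N \<Longrightarrow>
       ray_dist2 V1 V2 m \<sigma> \<le> \<rho>\<^sup>2 \<Longrightarrow> label V1 u * mean_field V1 V2 pin pout alph \<sigma> u \<ge> 2 * \<gamma>"
    and f: "\<And>\<sigma>. \<sigma> \<in> configs N \<Longrightarrow> f \<sigma> \<le> 1" "\<And>\<sigma>. \<sigma> \<in> configs N \<Longrightarrow> f \<sigma> \<le> 2 * lyapunov V1 V2 \<eta> k T \<sigma>"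
  shows "expect_at V1 V2 pin pout alph \<beta> \<eta> T f
    \<le> 4 ^ N * exp (4 * \<theta>\<^sup>2 * q * real N ^ 2 - \<theta> * s)
      + 2 * (k * (4 / V1 + 4 / V2) + drift_bound V1 V2 k \<rho> (N * \<epsilon> + s / \<gamma>) * T)"
proof -
  let ?bad = "{E \<in> Pow (pairs N). \<exists>\<sigma>\<in>configs N. (\<Sum>u<N. \<bar>noise N V1 pin pout E \<sigma> u\<bar>) > s}"
  let ?\<kappa> = "drift_bound V1 V2 k \<rho> (N * \<epsilon> + s / \<gamma>)"
  let ?B = "2 * (k * (4 / V1 + 4 / V2) + ?\<kappa> * T)"
  let ?P = "\<lambda>E \<sigma>0 \<sigma>. ctmc_trans (configs N) (generator N E alph \<beta>) T \<sigma>0 \<sigma>"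
  let ?G = "graph_prob N V1 pin pout" and ?I = "init_prob N V1 \<eta>"
  define H where "H E = (\<Sum>\<sigma>0\<in>configs N. ?I \<sigma>0 * (\<Sum>\<sigma>\<in>configs N. ?P E \<sigma>0 \<sigma> * f \<sigma>))" for E
  have G: "?G E \<ge> 0" for E using p by (intro graph_prob_nonneg) auto
  have I: "?I \<sigma> \<ge> 0" for \<sigma> by (rule init_prob_nonneg[OF \<eta>])
  have P: "?P E \<sigma>0 \<sigma> \<ge> 0" if "\<sigma>0 \<in> configs N" "\<sigma> \<in> configs N" for E \<sigma>0 \<sigma>
    using that T by (intro ctmc_trans_nonneg generator_nonneg) auto
  have P1: "(\<Sum>\<sigma>\<in>configs N. ?P E \<sigma>0 \<sigma>) = 1" if "\<sigma>0 \<in> configs N" for E \<sigma>0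
    using that by (intro ctmc_trans_row_sum generator_row_sum) auto
  have B0: "?B \<ge> 0"
    using k T drift_bound_nonneg[OF k] by (intro mult_nonneg_nonneg add_nonneg_nonneg) auto
  have H1: "H E \<le> 1" for E
  proof -
    have "H E \<le> (\<Sum>\<sigma>0\<in>configs N. ?I \<sigma>0 * (\<Sum>\<sigma>\<in>configs N. ?P E \<sigma>0 \<sigma> * 1))"
      unfolding H_def by (intro sum_mono mult_left_mono f P I)
    then show ?thesis by (simp add: P1 init_prob_sum)
  qed
  have HB: "H E \<le> ?B" if E: "E \<in> Pow (pairs N) - ?bad" for E
  proof -
    have noise: "(\<Sum>u<N. \<bar>noise N V1 pin pout E \<sigma> u\<bar>) \<le> s" if "\<sigma> \<in> configs N" for \<sigma>
      using E that by (auto simp: not_less)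
    have "H E \<le> (\<Sum>\<sigma>0\<in>configs N. ?I \<sigma>0 * (2 * (k * ray_dist2 V1 V2 \<eta> \<sigma>0 + ?\<kappa> * T)))"
      unfolding H_def
    proof (intro sum_mono mult_left_mono I)
      fix \<sigma>0 assume \<sigma>0: "\<sigma>0 \<in> configs N"
      have "(\<Sum>\<sigma>\<in>configs N. ?P E \<sigma>0 \<sigma> * f \<sigma>) \<le> (\<Sum>\<sigma>\<in>configs N. ?P E \<sigma>0 \<sigma> * (2 * lyapunov V1 V2 \<eta> k T \<sigma>))"
        by (intro sum_mono mult_left_mono f P \<sigma>0)
      also have "\<dots> = 2 * (\<Sum>\<sigma>\<in>configs N. ?P E \<sigma>0 \<sigma> * lyapunov V1 V2 \<eta> k T \<sigma>)"
        by (simp add: sum_distrib_left mult_ac)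
      also have "\<dots> \<le> 2 * (k * ray_dist2 V1 V2 \<eta> \<sigma>0 + ?\<kappa> * T)"
        using lyapunov_expectation_le[OF V k \<eta> T \<gamma> \<epsilon> \<beta>, folded N_def, OF noise field \<sigma>0]
        by (intro mult_left_mono) auto
      finally show "(\<Sum>\<sigma>\<in>configs N. ?P E \<sigma>0 \<sigma> * f \<sigma>) \<le> 2 * (k * ray_dist2 V1 V2 \<eta> \<sigma>0 + ?\<kappa> * T)" .
    qed
    also have "\<dots> = 2 * (k * (\<Sum>\<sigma>0\<in>configs N. ?I \<sigma>0 * ray_dist2 V1 V2 \<eta> \<sigma>0)
        + (\<Sum>\<sigma>0\<in>configs N. ?I \<sigma>0) * (?\<kappa> * T))"
      by (simp add: sum_distrib_left sum_distrib_right sum.distrib distrib_left mult_ac)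
    also have "\<dots> \<le> ?B"
      using mult_left_mono[OF init_prob_ray_dist2_le[OF \<eta> V] k] by (simp add: init_prob_sum N_def)
    finally show ?thesis .
  qed
  have "expect_at V1 V2 pin pout alph \<beta> \<eta> T f = (\<Sum>E\<in>Pow (pairs N). ?G E * H E)"
    unfolding expect_at_def H_def N_def Let_def ..
  also have "\<dots> = (\<Sum>E\<in>Pow (pairs N) - ?bad. ?G E * H E) + (\<Sum>E\<in>?bad. ?G E * H E)"
    by (intro sum.subset_diff) auto
  also have "\<dots> \<le> (\<Sum>E\<in>Pow (pairs N) - ?bad. ?G E * ?B) + (\<Sum>E\<in>?bad. ?G E * 1)"
    by (intro add_mono sum_mono mult_left_mono G HB H1)
  \<comment> \<open>The bad graphs may be added back because \<open>?B\<close> is nonnegative; the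
    weights then sum to 1.\<close>
  also have "\<dots> \<le> (\<Sum>E\<in>Pow (pairs N). ?G E * ?B) + (\<Sum>E\<in>?bad. ?G E)"
    using B0 G by (intro add_mono sum_mono2 mult_nonneg_nonneg) auto
  also have "(\<Sum>E\<in>Pow (pairs N). ?G E * ?B) = ?B"
    by (simp only: sum_distrib_right[symmetric] graph_prob_sum mult_1)
  also have "(\<Sum>E\<in>?bad. ?G E) \<le> 4 ^ N * exp (4 * \<theta>\<^sup>2 * q * real N ^ 2 - \<theta> * s)"
    by (rule graph_prob_large_noise_le[OF p \<theta>])
  finally show ?thesis by simp
qed

section \<open>Asymptotics\<close>

text \<open>The leading term is at least \<open>\<eta> * G / 2\<close>. The deviations
  \<open>X\<close> and \<open>Y\<close> together, and the self-interaction \<open>y\<close>, each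
  cost at most \<open>\<eta> * G / 8\<close>.\<close>

lemma field_margin:
  fixes p q A B K \<rho> \<eta> G m X Y y z :: real
  assumes A: "0 \<le> A" "A \<le> K" and B: "0 \<le> B" "B \<le> K" and G: "p * A - q * B \<ge> G / 2" "G \<ge> 0"
    and m: "\<eta> \<le> m" "\<eta> \<ge> 0" and X: "\<bar>X\<bar> \<le> \<rho>" and Y: "\<bar>Y\<bar> \<le> \<rho>" and y: "\<bar>y\<bar> \<le> z"
    and small: "(\<bar>p\<bar> + \<bar>q\<bar>) * K * \<rho> \<le> \<eta> * G / 8" "\<bar>p\<bar> * z \<le> \<eta> * G / 8"
  shows "p * (A * (m + X) - y) + q * (B * (- m + Y)) \<ge> \<eta> * G / 4"
proof -
  have "m * (p * A - q * B) \<ge> \<eta> * (G / 2)" using G m by (intro mult_mono) auto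
  moreover have "\<bar>p * A * X\<bar> \<le> \<bar>p\<bar> * K * \<rho>"
    unfolding abs_mult using A X by (intro mult_mono) auto
  moreover have "\<bar>q * B * Y\<bar> \<le> \<bar>q\<bar> * K * \<rho>"
    unfolding abs_mult using B Y by (intro mult_mono) auto
  moreover have "\<bar>p * y\<bar> \<le> \<bar>p\<bar> * z" unfolding abs_mult using y by (intro mult_left_mono) auto
  moreover have "p * (A * (m + X) - y) + q * (B * (- m + Y))
      = m * (p * A - q * B) + p * A * X + q * B * Y - p * y" by (simp add: algebra_simps)
  moreover have "(\<bar>p\<bar> + \<bar>q\<bar>) * K * \<rho> = \<bar>p\<bar> * K * \<rho> + \<bar>q\<bar> * K * \<rho>" by (simp add: algebra_simps)
  ultimately show ?thesis using small by linarith
qed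

lemma mean_field_margin:
  fixes V1 V2 n :: nat
  assumes l: "l \<ge> 0" and \<sigma>: "\<sigma> \<in> configs (V1 + V2)" and u: "u < V1 + V2"
    and K: "V1 / n \<le> K" "V2 / n \<le> K"
    and G: "(a - \<alpha>) * (V1 / n) - (b - \<alpha>) * (V2 / n) \<ge> G / 2"
      "(a - \<alpha>) * (V2 / n) - (b - \<alpha>) * (V1 / n) \<ge> G / 2" "G \<ge> 0"
    and m: "\<eta> \<le> m" "\<eta> \<ge> 0" and \<rho>: "\<rho> \<ge> 0" and D: "ray_dist2 V1 V2 m \<sigma> \<le> \<rho>\<^sup>2"
    and small: "(\<bar>a - \<alpha>\<bar> + \<bar>b - \<alpha>\<bar>) * K * \<rho> \<le> \<eta> * G / 8" "\<bar>a - \<alpha>\<bar> * (1 / n) \<le> \<eta> * G / 8"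
  shows "label V1 u * mean_field V1 V2 (a * l / n) (b * l / n) (\<alpha> * l / n) \<sigma> u \<ge> l * (\<eta> * G / 4)"
proof -
  define X where "X = magnet {0..<V1} \<sigma> - m"
  define Y where "Y = magnet {V1..<V1 + V2} \<sigma> + m"
  have "X\<^sup>2 \<le> \<rho>\<^sup>2" "Y\<^sup>2 \<le> \<rho>\<^sup>2"
    using D zero_le_power2[of X] zero_le_power2[of Y]
    unfolding ray_dist2_def X_def[symmetric] Y_def[symmetric] by linarith+
  then have XY: "\<bar>X\<bar> \<le> \<rho>" "\<bar>Y\<bar> \<le> \<rho>"
    using \<rho> by (auto simp: abs_le_square_iff[symmetric])
  have M: "magnet {0..<V1} \<sigma> = m + X" "magnet {V1..<V1 + V2} \<sigma> = - m + Y"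
    by (auto simp: X_def Y_def)
  show ?thesis
  proof (cases "u < V1")
    case True
    have "(a - \<alpha>) * (V1 / n * (m + X) - \<sigma> u / n) + (b - \<alpha>) * (V2 / n * (- m + Y)) \<ge> \<eta> * G / 4"
      using \<sigma> u by (intro field_margin[OF _ K(1) _ K(2) G(1) G(3) m XY _ small]) auto
    from mult_left_mono[OF this l] show ?thesis
      using True by (simp add: label_def mean_field_def M algebra_simps diff_divide_distrib add_divide_distrib)
  next
    case False
    \<comment> \<open>Negating all spins exchanges the communities, so the same inequality applies
      with \<open>- Y\<close> and \<open>- X\<close> for the deviations.\<close>
    have "(a - \<alpha>) * (V2 / n * (m + - Y) - (- \<sigma> u / n)) + (b - \<alpha>) * (V1 / n * (- m + - X)) \<ge> \<eta> * G / 4"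
      using \<sigma> u XY by (intro field_margin[OF _ K(2) _ K(1) G(2) G(3) m _ _ _ small]) auto
    from mult_left_mono[OF this l] show ?thesis
      using False by (simp add: label_def mean_field_def M algebra_simps diff_divide_distrib add_divide_distrib)
  qed
qed

text \<open>Triangle inequality: the target is within \<open>\<epsilon> / 2\<close> of the point
  \<open>(1, -1)\<close> in each coordinate.\<close>

lemma err_gt_imp_ray_dist2_ge:
  assumes "err V1 V2 \<sigma> > \<epsilon>" "0 \<le> 1 - m" "1 - m \<le> \<epsilon> / 2"
  shows "ray_dist2 V1 V2 m \<sigma> \<ge> (\<epsilon> / 2)\<^sup>2"
proof -
  let ?X = "magnet {0..<V1} \<sigma> - m" and ?Y = "magnet {V1..<V1 + V2} \<sigma> + m"
  have "\<bar>?X\<bar> \<ge> \<epsilon> / 2 \<or> \<bar>?Y\<bar> \<ge> \<epsilon> / 2"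
    using assms unfolding err_def less_max_iff_disj by linarith
  then have "?X\<^sup>2 \<ge> (\<epsilon> / 2)\<^sup>2 \<or> ?Y\<^sup>2 \<ge> (\<epsilon> / 2)\<^sup>2"
    using assms power_mono[of "\<epsilon> / 2" "\<bar>?X\<bar>" 2] power_mono[of "\<epsilon> / 2" "\<bar>?Y\<bar>" 2] by auto
  then show ?thesis
    unfolding ray_dist2_def using zero_le_power2[of ?X] zero_le_power2[of ?Y] by linarith
qed

section \<open>Bounds on the error, monotonicity and affinity of the expectation\<close>

lemma abs_magnet_le_1:
  assumes "\<And>u. u \<in> A \<Longrightarrow> \<bar>\<sigma> u\<bar> = 1"
  shows "\<bar>magnet A \<sigma>\<bar> \<le> 1"
proof -
  have "\<bar>\<Sum>u\<in>A. \<sigma> u\<bar> \<le> (\<Sum>u\<in>A. \<bar>\<sigma> u\<bar>)" by (rule sum_abs)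
  also have "\<dots> = card A" using assms by simp
  \<comment> \<open>If \<open>card A = 0\<close>, the magnetisation is 0, the value of a division by
    zero.\<close>
  finally show ?thesis by (cases "card A = 0") (auto simp: magnet_def abs_divide field_simps)
qed

lemma err_le_2:
  assumes "\<sigma> \<in> configs (V1 + V2)"
  shows "err V1 V2 \<sigma> \<le> 2"
proof -
  have "\<bar>magnet {0..<V1} \<sigma>\<bar> \<le> 1" "\<bar>magnet {V1..<V1 + V2} \<sigma>\<bar> \<le> 1"
    using abs_configs[OF assms] by (auto intro!: abs_magnet_le_1)
  then show ?thesis unfolding err_def by auto
qed

lemma err_nonneg: "err V1 V2 \<sigma> \<ge> 0"
  by (simp add: err_def)

lemma expect_at_mono:
  assumes p: "0 \<le> pin" "pin \<le> 1" "0 \<le> pout" "pout \<le> 1" and \<eta>: "0 \<le> \<eta>" "\<eta> \<le> 1" and T: "T \<ge> 0"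
    and fg: "\<And>\<sigma>. \<sigma> \<in> configs (V1 + V2) \<Longrightarrow> f \<sigma> \<le> g \<sigma>"
  shows "expect_at V1 V2 pin pout alph \<beta> \<eta> T f \<le> expect_at V1 V2 pin pout alph \<beta> \<eta> T g"
  unfolding expect_at_def Let_def using T
  by (intro sum_mono mult_left_mono fg graph_prob_nonneg p init_prob_nonneg \<eta> ctmc_trans_nonneg
      generator_nonneg) auto

lemma weighted_sum_affine:
  fixes w h :: "'i \<Rightarrow> real"
  assumes "(\<Sum>i\<in>A. w i) = 1"
  shows "(\<Sum>i\<in>A. w i * (x + y * h i)) = x + y * (\<Sum>i\<in>A. w i * h i)"
proof -
  have "(\<Sum>i\<in>A. w i * (x + y * h i)) = (\<Sum>i\<in>A. w i) * x + y * (\<Sum>i\<in>A. w i * h i)"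
    unfolding sum_distrib_left sum_distrib_right sum.distrib[symmetric]
    by (intro sum.cong) (auto simp: algebra_simps)
  then show ?thesis using assms by simp
qed

text \<open>The weights of graphs, of initial configurations and of transitions each sum to 1, so
  constants pass through all three sums.\<close>

lemma expect_at_affine:
  "expect_at V1 V2 pin pout alph \<beta> \<eta> T (\<lambda>\<sigma>. x + y * f \<sigma>) = x + y * expect_at V1 V2 pin pout alph \<beta> \<eta> T f"
  unfolding expect_at_def Let_def
  by (simp add: weighted_sum_affine ctmc_trans_row_sum[OF finite_configs generator_row_sum]
      init_prob_sum graph_prob_sum cong: sum.cong)

section \<open>Error terms as explicit functions of \<lambda>\<close>

text \<open>Since \<open>a * l\<close> is at most \<open>n\<close>, terms of order
  \<open>1 / n\<close> are also of order \<open>1 / l\<close>, and all errors can be measured in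
  \<open>l\<close> alone.\<close>

lemma four_over_size_le:
  fixes w a l :: real and V n :: nat
  assumes "n > 0" "w > 0" "w \<le> V / n" "a > 0" "a * l \<le> n" "l > 0"
  shows "4 / real V \<le> 4 / (w * a) / l"
proof -
  have "w * (a * l) \<le> w * n" using assms by (intro mult_left_mono) auto
  also have "\<dots> \<le> V" using assms by (simp add: field_simps)
  finally have "w * a * l \<le> V" by simp
  moreover have "w * a * l > 0" using assms by simp
  ultimately have "4 / real V \<le> 4 / (w * a * l)"
    using assms by (intro divide_left_mono mult_pos_pos) linarith+
  then show ?thesis by simp
qed

text \<open>With rate tolerance \<open>1 / l\<close>, margin \<open>\<delta> * l\<close> and noise
  \<open>C * n * sqrt l\<close>, the total rate error is of order \<open>n / sqrt l\<close>.
  Dividing by a community size and squaring leaves order \<open>1 / l\<close>.\<close>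

lemma drift_bound_le:
  fixes l w a K C \<delta> \<rho> :: real and V1 V2 n :: nat
  assumes n: "n > 0" and w: "w > 0" "w \<le> V1 / n" "w \<le> V2 / n" and al: "a > 0" "a * l \<le> n" and l: "l \<ge> 1"
    and K: "V1 / n + V2 / n \<le> K" "K \<ge> 0" and C: "C \<ge> 0" and \<delta>: "\<delta> > 0"
  shows "drift_bound V1 V2 (sqrt l) \<rho> (real (V1 + V2) * (1 / l) + C * n * sqrt l / (\<delta> * l))
    \<le> sqrt l * ((2 * (2 / w * (K + C / \<delta>))\<^sup>2 + 8 / (w * a)) / l) + 16 * sqrt l * exp (- sqrt l * \<rho>\<^sup>2)"
proof -
  have sl: "sqrt l \<ge> 1" "sqrt l * sqrt l = l" using l by auto
  have "sqrt l * 1 \<le> sqrt l * sqrt l" using sl by (intro mult_left_mono) auto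
  then have inv: "1 / l \<le> 1 / sqrt l" using sl l by (intro divide_left_mono) auto
  have sq: "sqrt l / l = 1 / sqrt l" using l by (simp add: real_div_sqrt field_simps)
  let ?x = "real (V1 + V2) * (1 / l) + C * n * sqrt l / (\<delta> * l)"
  let ?c = "2 / w * (K + C / \<delta>)"
  have N: "real (V1 + V2) \<le> K * n" using K n by (simp add: field_simps)
  have x: "?x \<le> n * (K + C / \<delta>) / sqrt l"
  proof -
    have "real (V1 + V2) * (1 / l) \<le> K * n * (1 / sqrt l)"
      using N inv l K by (intro mult_mono) auto
    moreover have "C * n * sqrt l / (\<delta> * l) = C * n / \<delta> * (1 / sqrt l)"
      unfolding sq[symmetric] by simp
    ultimately show ?thesis by (simp add: distrib_left add_divide_distrib mult_ac)
  qed
  have e: "(2 / real V * ?x)\<^sup>2 \<le> ?c\<^sup>2 / l" if V: "w \<le> V / n" for V :: nat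
  proof -
    have wn: "w * n \<le> V" "w * n > 0" using V n w by (auto simp: field_simps)
    have "2 / real V * ?x \<le> 2 / (w * n) * (n * (K + C / \<delta>) / sqrt l)"
      using wn x l K C \<delta> by (intro mult_mono divide_left_mono) auto
    also have "2 / (w * n) * (n * z / y) = 2 / w * z / y" for z y :: real using n by simp
    finally have "(2 / real V * ?x)\<^sup>2 \<le> (?c / sqrt l)\<^sup>2"
      using l C \<delta> by (intro power_mono) auto
    also have "(?c / sqrt l)\<^sup>2 = ?c\<^sup>2 / l"
      unfolding power_divide using l by simp
    finally show ?thesis .
  qed
  have f: "4 / real V \<le> 4 / (w * a) / l" if "w \<le> V / n" for V :: nat
    using four_over_size_le[OF n w(1) that al] l by simp
  have "(2 / V1 * ?x)\<^sup>2 + (2 / V2 * ?x)\<^sup>2 + 4 / V1 + 4 / V2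
      \<le> ?c\<^sup>2 / l + ?c\<^sup>2 / l + 4 / (w * a) / l + 4 / (w * a) / l"
    using e[OF w(2)] e[OF w(3)] f[OF w(2)] f[OF w(3)] by linarith
  also have "\<dots> = (2 * ?c\<^sup>2 + 8 / (w * a)) / l" by (simp add: add_divide_distrib)
  finally show ?thesis unfolding drift_bound_def
    using sl by (intro add_mono mult_left_mono) auto
qed

text \<open>Over a horizon of order \<open>ln l\<close> no term exceeds the order
  \<open>ln l / sqrt l\<close>.\<close>

lemma bound_tendsto_0:
  fixes A B c r :: real
  assumes "r > 0"
  shows "((\<lambda>l. 2 * (sqrt l * (A / l) + (sqrt l * (B / l) + 16 * sqrt l * exp (- sqrt l * r)) * (c * ln l))) \<longlongrightarrow> 0) at_top"
proof -
  have "((\<lambda>l::real. sqrt l / l) \<longlongrightarrow> 0) at_top" by real_asymp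
  moreover have "((\<lambda>l::real. sqrt l / l * ln l) \<longlongrightarrow> 0) at_top" by real_asymp
  moreover have "((\<lambda>l. sqrt l * exp (- sqrt l * r) * ln l) \<longlongrightarrow> 0) at_top" using assms by real_asymp
  ultimately have "((\<lambda>l. 2 * A * (sqrt l / l) + 2 * B * c * (sqrt l / l * ln l)
      + 32 * c * (sqrt l * exp (- sqrt l * r) * ln l)) \<longlongrightarrow> 2 * A * 0 + 2 * B * c * 0 + 32 * c * 0) at_top"
    by (intro tendsto_intros)
  then show ?thesis by (simp add: algebra_simps)
qed

text \<open>With \<open>\<theta> = 1 / sqrt l\<close> all exponents are linear in \<open>n\<close>:
  the union bound costs \<open>2 * K * n\<close> because 4 is at most \<open>exp 2\<close>, the
  variance term costs \<open>4 * a * K\<^sup>2 * n\<close>, and the threshold gains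
  \<open>C * n\<close>.\<close>

lemma power_exp_bound:
  fixes K a C :: real
  assumes n: "n > 0" and N: "real N \<le> K * n" and l: "l > 0" and a: "a \<ge> 0" and C: "C \<ge> 2 * K + 4 * a * K\<^sup>2 + 1"
  shows "4 ^ N * exp (4 * (1 / sqrt l)\<^sup>2 * (a * l / n) * real N ^ 2 - 1 / sqrt l * (C * n * sqrt l)) \<le> exp (- real n)"
proof -
  have "(4::real) = (1 + 1)\<^sup>2" by simp
  also have "\<dots> \<le> (exp 1)\<^sup>2" using exp_ge_add_one_self[of 1] by (intro power_mono) auto
  also have "\<dots> = exp 2" using exp_double[of "1::real"] by simp
  finally have "(4::real) ^ N \<le> exp 2 ^ N" by (intro power_mono) auto
  also have "\<dots> = exp (2 * N)" by (simp add: exp_of_nat_mult[symmetric] mult.commute)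
  finally have 4: "(4::real) ^ N \<le> exp (2 * N)" .
  have "real N ^ 2 \<le> (K * n)\<^sup>2" using N by (intro power_mono) auto
  then have "4 * a / n * real N ^ 2 \<le> 4 * a / n * (K * n)\<^sup>2" using a by (intro mult_left_mono) auto
  also have "\<dots> = 4 * a * K\<^sup>2 * n" using n by (simp add: power2_eq_square)
  finally have q: "4 * a / n * real N ^ 2 \<le> 4 * a * K\<^sup>2 * n" .
  have "4 * (1 / sqrt l)\<^sup>2 * (a * l / n) * real N ^ 2 - 1 / sqrt l * (C * n * sqrt l)
      = 4 * a / n * real N ^ 2 - C * n"
    using l by (simp add: power_divide)
  then have "4 ^ N * exp (4 * (1 / sqrt l)\<^sup>2 * (a * l / n) * real N ^ 2 - 1 / sqrt l * (C * n * sqrt l))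
      \<le> exp (2 * N) * exp (4 * a / n * real N ^ 2 - C * n)"
    using 4 by (intro mult_mono) auto
  also have "\<dots> \<le> exp (- real n)"
    unfolding exp_add[symmetric]
    using q N mult_right_mono[OF C, of "real n"] by (simp add: algebra_simps)
  finally show ?thesis .
qed

theorem theorem3p2:
  fixes a b \<alpha> \<eta> c v1 v2 :: real
    and lam :: "nat \<Rightarrow> real" and \<beta> :: "nat \<Rightarrow> ereal"
    and V1 V2 :: "nat \<Rightarrow> nat"
  assumes ab: "a > b" "b > 0"
    and eta: "0 < \<eta>" "\<eta> \<le> 1"
    and lam_prob: "\<forall>\<^sub>F n in sequentially. a * lam n \<le> real n"
    and lam_lim: "filterlim lam at_top sequentially"
    and V1_lim: "(\<lambda>n. real (V1 n) / real n) \<longlonglongrightarrow> v1"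
    and V2_lim: "(\<lambda>n. real (V2 n) / real n) \<longlonglongrightarrow> v2"
    and v_pos: "v1 > 0" "v2 > 0"
    and v_ord: "v1 \<ge> v2"
    and alpha: "v1 > v2 \<longrightarrow> (b * v1 - a * v2) / (v1 - v2) < \<alpha> \<and> \<alpha> < (a * v1 - b * v2) / (v1 - v2)"
    and beta_pos: "\<And>n. \<beta> n > 0"
    and beta_lim: "(\<lambda>n. \<beta> n * ereal (lam n / ln (lam n))) \<longlonglongrightarrow> \<infinity>"
    and c: "0 < c" "c < 1/4"
  shows "(\<forall>\<epsilon>>0. (\<lambda>n. expect_at (V1 n) (V2 n) (a * lam n / n) (b * lam n / n) (\<alpha> * lam n / n)
                        (\<beta> n) \<eta> (c * ln (lam n))
                        (\<lambda>\<sigma>. if err (V1 n) (V2 n) \<sigma> > \<epsilon> then 1 else 0)) \<longlonglongrightarrow> 0)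
       \<and> (\<lambda>n. expect_at (V1 n) (V2 n) (a * lam n / n) (b * lam n / n) (\<alpha> * lam n / n)
                        (\<beta> n) \<eta> (c * ln (lam n)) (err (V1 n) (V2 n))) \<longlonglongrightarrow> 0"
proof -
  let ?X = "\<lambda>n. expect_at (V1 n) (V2 n) (a * lam n / n) (b * lam n / n) (\<alpha> * lam n / n) (\<beta> n) \<eta> (c * ln (lam n))"
  let ?I = "\<lambda>\<epsilon> n \<sigma>. if err (V1 n) (V2 n) \<sigma> > \<epsilon> then 1 else (0::real)"
  have a: "a > 0" using ab by simp
  have lam_ge: "\<forall>\<^sub>F n in sequentially. lam n \<ge> x" for x
    using lam_lim by (simp add: filterlim_at_top)
  have probs: "\<forall>\<^sub>F n in sequentially. n > 0 \<and> 0 \<le> b * lam n / n \<and> b * lam n / n \<le> a * lam n / n \<and> a * lam n / n \<le> 1 \<and> b * lam n / n \<le> 1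
      \<and> c * ln (lam n) \<ge> 0"
    using lam_prob lam_ge[of 1] eventually_gt_at_top[of 0]
  proof eventually_elim
    case (elim n)
    have "b * lam n \<le> a * lam n" using elim ab by (intro mult_right_mono) auto
    moreover from this have "b * lam n \<le> n" using elim by linarith
    ultimately show ?case using elim ab c by (auto simp: divide_right_mono)
  qed
  have X_nonneg: "\<forall>\<^sub>F n in sequentially. \<forall>f. (\<forall>\<sigma>. f \<sigma> \<ge> (0::real)) \<longrightarrow> 0 \<le> ?X n f"
    using probs
  proof (eventually_elim, intro allI impI)
    fix n and f :: "(nat \<Rightarrow> real) \<Rightarrow> real" assume elim: "n > 0 \<and> 0 \<le> b * lam n / n \<and> b * lam n / n \<le> a * lam n / n \<and> a * lam n / n \<le> 1 \<and> b * lam n / n \<le> 1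
      \<and> c * ln (lam n) \<ge> 0" and f: "\<forall>\<sigma>. 0 \<le> f \<sigma>"
    \<comment> \<open>The zero function is written in affine form so that
      \<open>expect_at_affine\<close> evaluates its expectation.\<close>
    have "?X n (\<lambda>\<sigma>. 0 + 0 * f \<sigma>) \<le> ?X n f"
      using elim f eta by (intro expect_at_mono) auto
    then show "0 \<le> ?X n f" unfolding expect_at_affine by simp
  qed

  \<comment> \<open>Positivity of the mean field margin and choice of constants\<close>
  define G where "G = min ((a - \<alpha>) * v1 - (b - \<alpha>) * v2) ((a - \<alpha>) * v2 - (b - \<alpha>) * v1)"
  have G_le: "G \<le> (a - \<alpha>) * v1 - (b - \<alpha>) * v2" "G \<le> (a - \<alpha>) * v2 - (b - \<alpha>) * v1"
    by (simp_all add: G_def)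
  \<comment> \<open>\<open>G\<close> is the smaller of the two limiting mean fields at the point
    \<open>(1, -1)\<close>, each multiplied by its label and divided by \<lambda>. For unequal sizes
    its two entries are positive by the upper and the lower bound on \<alpha>; for equal sizes
    \<alpha> cancels.\<close>
  have G: "G > 0"
  proof (cases "v1 > v2")
    case True
    with alpha have "b * v1 - a * v2 < \<alpha> * (v1 - v2)" "\<alpha> * (v1 - v2) < a * v1 - b * v2"
      by (simp_all add: pos_divide_less_eq pos_less_divide_eq)
    then show ?thesis by (simp add: G_def algebra_simps)
  next
    case False
    then have "v1 = v2" using v_ord by simp
    moreover have "b * v2 < a * v2" using ab v_pos by simp
    ultimately show ?thesis by (simp add: G_def algebra_simps)
  qed
  \<comment> \<open>\<open>K\<close> and \<open>w\<close> bound the community sizes over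
    \<open>n\<close> from above and below, \<open>2 * \<delta>\<close> is the margin
    \<open>\<eta> * G / 4\<close> of \<open>mean_field_margin\<close>, \<open>\<rho>\<close> makes
    its smallness condition hold, and \<open>C\<close> is the constant of
    \<open>power_exp_bound\<close>. The added 1 keeps \<open>L\<close> positive.\<close>
  define K where "K = v1 + v2 + 1"
  define w where "w = v2 / 2"
  define L where "L = \<bar>a - \<alpha>\<bar> + \<bar>b - \<alpha>\<bar> + 1"
  define \<rho> where "\<rho> = \<eta> * G / (8 * K * L)"
  define \<delta> where "\<delta> = \<eta> * G / 8"
  define C where "C = 2 * K + 4 * a * K\<^sup>2 + 1"
  have K: "K > 0" using v_pos by (simp add: K_def)
  have L: "L > 0" by (simp add: L_def)
  have \<rho>: "\<rho> > 0" using eta G K L by (simp add: \<rho>_def)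
  have \<delta>: "\<delta> > 0" using eta G by (simp add: \<delta>_def)
  have w: "w > 0" using v_pos by (simp add: w_def)
  have C: "C > 0" using a K by (simp add: C_def add_pos_pos)
  have \<rho>_small: "(\<bar>a - \<alpha>\<bar> + \<bar>b - \<alpha>\<bar>) * K * \<rho> \<le> \<eta> * G / 8"
  proof -
    have "(\<bar>a - \<alpha>\<bar> + \<bar>b - \<alpha>\<bar>) * K * \<rho> \<le> L * K * \<rho>"
      using K \<rho> by (intro mult_right_mono) (auto simp: L_def)
    also have "\<dots> = \<eta> * G / 8" using K L by (simp add: \<rho>_def)
    finally show ?thesis .
  qed

  \<comment> \<open>Estimates that hold for all large \<open>n\<close>\<close>
  have "(\<lambda>n. V1 n / n + V2 n / n) \<longlonglongrightarrow> v1 + v2" by (intro tendsto_intros V1_lim V2_lim)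
  then have ev_K: "\<forall>\<^sub>F n in sequentially. V1 n / n + V2 n / n < K"
    by (rule order_tendstoD) (simp add: K_def)
  have ev_w1: "\<forall>\<^sub>F n in sequentially. w < V1 n / n"
    by (rule order_tendstoD[OF V1_lim]) (use v_pos v_ord in \<open>simp add: w_def\<close>)
  have ev_w2: "\<forall>\<^sub>F n in sequentially. w < V2 n / n"
    by (rule order_tendstoD[OF V2_lim]) (use v_pos in \<open>simp add: w_def\<close>)
  have "(\<lambda>n. (a - \<alpha>) * (V1 n / n) - (b - \<alpha>) * (V2 n / n)) \<longlonglongrightarrow> (a - \<alpha>) * v1 - (b - \<alpha>) * v2"
    by (intro tendsto_intros V1_lim V2_lim)
  then have ev_G1: "\<forall>\<^sub>F n in sequentially. G / 2 < (a - \<alpha>) * (V1 n / n) - (b - \<alpha>) * (V2 n / n)"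
    by (rule order_tendstoD) (use G G_le in linarith)
  have "(\<lambda>n. (a - \<alpha>) * (V2 n / n) - (b - \<alpha>) * (V1 n / n)) \<longlonglongrightarrow> (a - \<alpha>) * v2 - (b - \<alpha>) * v1"
    by (intro tendsto_intros V1_lim V2_lim)
  then have ev_G2: "\<forall>\<^sub>F n in sequentially. G / 2 < (a - \<alpha>) * (V2 n / n) - (b - \<alpha>) * (V1 n / n)"
    by (rule order_tendstoD) (use G G_le in linarith)
  have "(\<lambda>n. \<bar>a - \<alpha>\<bar> * (1 / real n)) \<longlonglongrightarrow> \<bar>a - \<alpha>\<bar> * 0"
    by (intro tendsto_intros lim_1_over_n)
  then have ev_n: "\<forall>\<^sub>F n in sequentially. \<bar>a - \<alpha>\<bar> * (1 / real n) < \<eta> * G / 8"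
    by (rule order_tendstoD) (use G eta in simp)
  \<comment> \<open>Beyond the threshold \<open>1 / (2 * \<delta>)\<close> the logistic tail at
    margin \<open>\<delta> * lam n\<close> drops below \<open>1 / lam n\<close>.\<close>
  have "\<forall>\<^sub>F n in sequentially. ereal (1 / (2 * \<delta>)) < \<beta> n * ereal (lam n / ln (lam n))"
    using beta_lim by (simp add: tendsto_PInfty)
  then have ev_\<beta>: "\<forall>\<^sub>F n in sequentially. \<beta> n = \<infinity> \<or> exp (- 2 * real_of_ereal (\<beta> n) * (\<delta> * lam n)) \<le> 1 / lam n"
    using lam_ge[of 4]
  proof eventually_elim
    case (elim n)
    show ?case
    proof (cases "\<beta> n")
      case (real x)
      have ln: "ln (lam n) > 0" using elim by simp
      have "1 / (2 * \<delta>) < x * (lam n / ln (lam n))" using elim real by simp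
      then have "ln (lam n) < 2 * x * (\<delta> * lam n)" using ln \<delta> by (simp add: field_simps)
      then have "exp (- 2 * x * (\<delta> * lam n)) \<le> exp (- ln (lam n))" by simp
      also have "\<dots> = 1 / lam n" using elim by (simp add: exp_minus inverse_eq_divide)
      finally show ?thesis using real by simp
    qed (use beta_pos[of n] in auto)
  qed

  \<comment> \<open>Convergence in probability\<close>
  have prob_conv: "(\<lambda>n. ?X n (?I \<epsilon> n)) \<longlonglongrightarrow> 0" if \<epsilon>: "\<epsilon> > 0" for \<epsilon>
  proof -
    define B where "B l = 2 * (sqrt l * (8 / (w * a) / l) +
        (sqrt l * ((2 * (2 / w * (K + C / \<delta>))\<^sup>2 + 8 / (w * a)) / l) + 16 * sqrt l * exp (- sqrt l * \<rho>\<^sup>2)) * (c * ln l))"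
      for l
    \<comment> \<open>At time \<open>c * ln l\<close> the target differs from \<open>(1, -1)\<close>
      by \<open>1 - \<eta>\<close> times \<open>l\<close> to the power \<open>- c\<close> in each
      coordinate.\<close>
    have "((\<lambda>l. (1 - \<eta>) * exp (- (c * ln l))) \<longlongrightarrow> (1 - \<eta>) * 0) at_top"
      by (intro tendsto_mult_left) (use c in real_asymp)
    then have "\<forall>\<^sub>F l in at_top. (1 - \<eta>) * exp (- (c * ln l)) < \<epsilon> / 2"
      by (rule order_tendstoD) (use \<epsilon> in simp)
    then have ev_m: "\<forall>\<^sub>F n in sequentially. (1 - \<eta>) * exp (- (c * ln (lam n))) < \<epsilon> / 2"
      using lam_lim by (rule eventually_compose_filterlim)
    have "0 < (\<epsilon> / 2)\<^sup>2" using \<epsilon> by simp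
    then have "((\<lambda>l. exp (- sqrt l * (\<epsilon> / 2)\<^sup>2)) \<longlongrightarrow> 0) at_top" by real_asymp
    then have "\<forall>\<^sub>F l in at_top. exp (- sqrt l * (\<epsilon> / 2)\<^sup>2) < 1 / 2"
      by (rule order_tendstoD) simp
    then have ev_half: "\<forall>\<^sub>F n in sequentially. exp (- sqrt (lam n) * (\<epsilon> / 2)\<^sup>2) < 1 / 2"
      using lam_lim by (rule eventually_compose_filterlim)
    have upper: "\<forall>\<^sub>F n in sequentially. ?X n (?I \<epsilon> n) \<le> exp (- real n) + B (lam n)"
      using probs lam_prob lam_ge[of 4] ev_K ev_w1 ev_w2 ev_G1 ev_G2 ev_n ev_\<beta> ev_m ev_half
    proof eventually_elim
      case (elim n)
      let ?l = "lam n" and ?N = "V1 n + V2 n" and ?T = "c * ln (lam n)"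
      have n: "n > 0" and l: "?l \<ge> 4" using elim by auto
      have V: "V1 n > 0" "V2 n > 0" using elim w by (auto intro: gr0I)
      have N: "real ?N \<le> K * n" using elim n by (simp add: field_simps)
      \<comment> \<open>This yields \<open>\<theta> \<le> 1/2\<close> for
        \<open>\<theta> = 1 / sqrt ?l\<close>.\<close>
      have sl: "sqrt ?l \<ge> 2" using l real_sqrt_le_mono[of 4 ?l] by simp
      have V_le: "V1 n / n \<le> K" "V2 n / n \<le> K"
        using elim divide_nonneg_nonneg[of "real (V1 n)" "real n"] divide_nonneg_nonneg[of "real (V2 n)" "real n"]
        by linarith+
      have field: "label (V1 n) u * mean_field (V1 n) (V2 n) (a * ?l / n) (b * ?l / n) (\<alpha> * ?l / n) \<sigma> u
          \<ge> 2 * (\<delta> * ?l)"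
        if "\<eta> \<le> m" "m \<le> 1" "\<sigma> \<in> configs ?N" "u < ?N" "ray_dist2 (V1 n) (V2 n) m \<sigma> \<le> \<rho>\<^sup>2" for m \<sigma> u
        using mean_field_margin[of ?l \<sigma> "V1 n" "V2 n" u n K G a \<alpha> b \<eta> m \<rho>] that elim V_le \<rho> \<rho>_small eta G
        by (simp add: \<delta>_def mult_ac)
      have T0: "?T \<ge> 0" using elim by simp
      \<comment> \<open>On the error event the squared distance is at least
        \<open>(\<epsilon> / 2)\<^sup>2\<close>, so the Lyapunov function exceeds one half by
        \<open>ev_half\<close>; elsewhere it is nonnegative.\<close>
      have ind: "?I \<epsilon> n \<sigma> \<le> 2 * lyapunov (V1 n) (V2 n) \<eta> (sqrt ?l) ?T \<sigma>" for \<sigma>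
      proof (cases "err (V1 n) (V2 n) \<sigma> > \<epsilon>")
        case True
        have m: "0 \<le> 1 - ray_time \<eta> ?T" "1 - ray_time \<eta> ?T \<le> \<epsilon> / 2"
          using elim eta by (auto simp: ray_time_def)
        have "exp (- sqrt ?l * ray_dist2 (V1 n) (V2 n) (ray_time \<eta> ?T) \<sigma>) \<le> exp (- sqrt ?l * (\<epsilon> / 2)\<^sup>2)"
          using mult_left_mono[OF err_gt_imp_ray_dist2_ge[OF True m], of "sqrt ?l"] l by simp
        also have "\<dots> < 1 / 2" using elim by blast
        finally show ?thesis using True by (simp add: lyapunov_def)
      next
        case False
        have "0 \<le> sqrt ?l * ray_dist2 (V1 n) (V2 n) (ray_time \<eta> ?T) \<sigma>"
          using l by (intro mult_nonneg_nonneg) (auto simp: ray_dist2_def)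
        then show ?thesis using False by (simp add: lyapunov_def)
      qed
      let ?\<kappa> = "drift_bound (V1 n) (V2 n) (sqrt ?l) \<rho> (real ?N * (1 / ?l) + C * n * sqrt ?l / (\<delta> * ?l))"
      \<comment> \<open>Parameters: \<open>k = sqrt ?l\<close>,
        \<open>\<theta> = 1 / sqrt ?l\<close>, noise threshold \<open>C * n * sqrt ?l\<close>,
        margin \<open>\<delta> * ?l\<close> and rate tolerance \<open>1 / ?l\<close>.\<close>
      have "?X n (?I \<epsilon> n) \<le> 4 ^ ?N * exp (4 * (1 / sqrt ?l)\<^sup>2 * (a * ?l / n) * real ?N ^ 2 - 1 / sqrt ?l * (C * n * sqrt ?l))
          + 2 * (sqrt ?l * (4 / V1 n + 4 / V2 n) + ?\<kappa> * ?T)"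
        by (rule expect_at_le[where \<gamma> = "\<delta> * ?l"]) (use V l elim eta T0 \<delta> beta_pos field ind sl in auto)
      also have "\<dots> \<le> exp (- real n) + B ?l"
      proof (rule add_mono)
        show "4 ^ ?N * exp (4 * (1 / sqrt ?l)\<^sup>2 * (a * ?l / n) * real ?N ^ 2 - 1 / sqrt ?l * (C * n * sqrt ?l)) \<le> exp (- real n)"
          using n N l a by (intro power_exp_bound[where K = K]) (auto simp: C_def)
        have drift: "?\<kappa> * ?T \<le> (sqrt ?l * ((2 * (2 / w * (K + C / \<delta>))\<^sup>2 + 8 / (w * a)) / ?l) + 16 * sqrt ?l * exp (- sqrt ?l * \<rho>\<^sup>2)) * ?T"
          using n w elim a l K C \<delta> T0 by (intro mult_right_mono drift_bound_le) auto
        have "4 / V1 n + 4 / V2 n \<le> 4 / (w * a) / ?l + 4 / (w * a) / ?l"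
          using n w a l elim by (intro add_mono four_over_size_le) auto
        then have "4 / V1 n + 4 / V2 n \<le> 8 / (w * a) / ?l" by (simp add: mult_ac)
        then have init: "sqrt ?l * (4 / V1 n + 4 / V2 n) \<le> sqrt ?l * (8 / (w * a) / ?l)"
          using l by (intro mult_left_mono) auto
        show "2 * (sqrt ?l * (4 / V1 n + 4 / V2 n) + ?\<kappa> * ?T) \<le> B ?l"
          unfolding B_def by (rule mult_left_mono[OF add_mono[OF init drift]]) simp
      qed
      finally show ?case .
    qed
    have "(B \<longlongrightarrow> 0) at_top"
      unfolding B_def using \<rho> by (intro bound_tendsto_0) auto
    then have "(\<lambda>n. B (lam n)) \<longlonglongrightarrow> 0"
      using lam_lim by (rule filterlim_compose)
    moreover have "(\<lambda>n. exp (- real n)) \<longlonglongrightarrow> 0" by real_asymp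
    ultimately have "(\<lambda>n. exp (- real n) + B (lam n)) \<longlonglongrightarrow> 0 + 0" by (intro tendsto_add)
    then have lim: "(\<lambda>n. exp (- real n) + B (lam n)) \<longlonglongrightarrow> 0" by simp
    have "\<forall>\<^sub>F n in sequentially. 0 \<le> ?X n (?I \<epsilon> n)"
      using X_nonneg by eventually_elim auto
    then show ?thesis
      by (rule tendsto_sandwich[OF _ upper tendsto_const lim])
  qed

  \<comment> \<open>Convergence of the expectation\<close>
  have "(\<lambda>n. ?X n (err (V1 n) (V2 n))) \<longlonglongrightarrow> 0"
  proof (rule order_tendstoI)
    fix x :: real assume x: "x < 0"
    show "\<forall>\<^sub>F n in sequentially. x < ?X n (err (V1 n) (V2 n))"
      using X_nonneg
    proof eventually_elim
      case (elim n)
      then have "0 \<le> ?X n (err (V1 n) (V2 n))" using err_nonneg by blast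
      then show ?case using x by simp
    qed
  next
    fix x :: real assume x: "0 < x"
    have "\<forall>\<^sub>F n in sequentially. ?X n (?I (x / 2) n) < x / 4"
      by (rule order_tendstoD[OF prob_conv]) (use x in auto)
    then show "\<forall>\<^sub>F n in sequentially. ?X n (err (V1 n) (V2 n)) < x"
      using probs
    proof eventually_elim
      case (elim n)
      \<comment> \<open>As the error is at most 2, it is below \<open>x / 2\<close> plus twice the
        indicator that it exceeds \<open>x / 2\<close>; the latter has expectation below
        \<open>x / 4\<close>.\<close>
      have "?X n (err (V1 n) (V2 n)) \<le> ?X n (\<lambda>\<sigma>. x / 2 + 2 * ?I (x / 2) n \<sigma>)"
      proof (rule expect_at_mono)
        show "err (V1 n) (V2 n) \<sigma> \<le> x / 2 + 2 * ?I (x / 2) n \<sigma>" if "\<sigma> \<in> configs (V1 n + V2 n)" for \<sigma>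
          using err_le_2[OF that] x by auto
      qed (use elim eta in auto)
      also have "\<dots> = x / 2 + 2 * ?X n (?I (x / 2) n)" by (rule expect_at_affine)
      finally show ?case using elim by simp
    qed
  qed
  then show ?thesis using prob_conv by blast
qed

end
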